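(* Let $|q|<1$ and let $k\geq 5$ be an integer. Then \[ \sum_{m_1,\dots,m_{k-2}\geq 0} \frac{q^{(m_1+m_2)^2+m_2^2+m_3^2+\cdots+m_{k-2}^2}}{(q)_{m_1}(q)_{2m_2}} \Bigl(\prod_{j=3}^{k-3}\begin{bmatrix}m_{j-1}+m_j-m_{j+1}\\ 2m_j\end{bmatrix}\Bigr) \begin{bmatrix}m_{k-3}\\ m_{k-2}\end{bmatrix} =\frac{(q^{F_kF_{k-2}},q^{F_kF_{k-2}+1},q^{2F_kF_{k-2}+1};q^{2F_kF_{k-2}+1})_{\infty}}{(q;q)_{\infty}}. \]
   Context: $F_k$ denotes the Fibonacci numbers: $F_0=0$, $F_1=1$, $F_k=F_{k-1}+F_{k-2}$. $(x;q)_n=\prod_{i=0}^{n-1}(1-xq^i)$ (with $n=\infty$ allowed), $(q)_n=(q;q)_n$, and $(x_1,\dots,x_r;q)_\infty=\prod_{i=1}^r(x_i;q)_\infty$. The $q$-binomial coefficient is $\begin{bmatrix}n\\ m\end{bmatrix}=\frac{(q)_n}{(q)_m(q)_{n-m}}$ if $m$ and $n-m$ are nonnegative integers and $0$ otherwise. An empty product equals $1$. *)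

theory Defs
  imports "HOL-Analysis.Analysis" "HOL-Number_Theory.Fib"
begin

definition qpoch :: "complex \<Rightarrow> complex \<Rightarrow> nat \<Rightarrow> complex" where
  "qpoch x q n = (\<Prod>i<n. 1 - x * q ^ i)"

definition qpoch_inf :: "complex \<Rightarrow> complex \<Rightarrow> complex" where
  "qpoch_inf x q = (\<Prod>i. 1 - x * q ^ i)"

definition qbinom :: "complex \<Rightarrow> int \<Rightarrow> int \<Rightarrow> complex" where
  "qbinom q n m = (if 0 \<le> m \<and> m \<le> n
     then qpoch q q (nat n) / (qpoch q q (nat m) * qpoch q q (nat (n - m))) else 0)"

text \<open>Index set: tuples (m_1,...,m_{k-2}) of nonnegative integers, encoded as
  functions nat => nat vanishing outside {1..k-2}.\<close>
definition idx :: "nat \<Rightarrow> (nat \<Rightarrow> nat) set" where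
  "idx k = {m. \<forall>i. i \<notin> {1..k-2} \<longrightarrow> m i = 0}"

definition summand :: "complex \<Rightarrow> nat \<Rightarrow> (nat \<Rightarrow> nat) \<Rightarrow> complex" where
  "summand q k m =
     q ^ ((m 1 + m 2)^2 + (\<Sum>i=2..k-2. (m i)^2))
     / (qpoch q q (m 1) * qpoch q q (2 * m 2))
     * (\<Prod>j=3..k-3. qbinom q (int (m (j-1)) + int (m j) - int (m (j+1))) (2 * int (m j)))
     * qbinom q (int (m (k-3))) (int (m (k-2)))"

end

(* For naturals b >= d put D(m,n;d,b) = [m-d; n-b] [m+d; n+b].  Burge's transformation, a form of
   the q-Saalschuetz sum, reads
     sum_i q^(i^2) [M+L-i; 2L] D(L,i;d,b) = q^(b^2) D(M,L;b-d,2b-d).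
   Summing over the last variables of the multisum one at a time iterates it, starting from the
   expansion of [m; n] in the D(m,n;0,j) that the unit Bailey pair provides; since (d,b) starts at
   (0,j) = (F_0 j, F_2 j) and (F_t, F_(t+2)) is mapped to (F_(t+1), F_(t+3)), Fibonacci numbers
   appear.  The remaining sums over m_3, m_2 and m_1+m_2 are three instances of the Bailey lemma, and
   the resulting theta series is evaluated by the Jacobi triple product. *)
theory Submission
  imports Defs
begin

section \<open>Gaussian binomial coefficients and q-Vandermonde sums\<close>

text \<open>The transformation can be iterated because its right side has the shape of its input: d
  <= b gives b - d <= 2b - d, so D(M,L;b-d,2b-d) can be fed in again. Each step also releases a
  square, and F_{t+1} F_{t+2} + F_{t+2}^2 = F_{t+2} F_{t+3} keeps the accumulated exponent a product
  of consecutive Fibonacci numbers. The sum over m_3 brings it to F_{k-3} F_{k-2}; the sums over m_2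
  and n = m_1 + m_2 add F_{k-2}^2 each, and F_{k-2} (F_{k-3} + 2 F_{k-2}) = F_{k-2} F_k is the
  number on the product side. The obstacle is that infinitely many tuples share the same n. A
  nonzero summand however forces n >= m_2 >= m_3 >= ..., so for fixed n the whole calculation is an
  identity of finite sums, and limits enter only in the sum over n and in the triple
  product.\<close>

fun gauss :: "complex \<Rightarrow> nat \<Rightarrow> nat \<Rightarrow> complex" where
  "gauss q n 0 = 1"
| "gauss q 0 (Suc k) = 0"
| "gauss q (Suc n) (Suc k) = gauss q n k + q ^ Suc k * gauss q n (Suc k)"

lemma gauss_eq_0: "n < k \<Longrightarrow> gauss q n k = 0"
  by (induction q n k rule: gauss.induct) auto

lemma gauss_self [simp]: "gauss q n n = 1"
  by (induction n) (auto simp: gauss_eq_0)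

text \<open>The companion of the defining q-Pascal rule. The recursion does not show the symmetry
  that exchanges the two rules, so the proof expands the new row by the first rule, the row above it
  by the induction hypothesis, and regroups.\<close>

lemma gauss_Suc_Suc':
  "k \<le> n \<Longrightarrow> gauss q (Suc n) (Suc k) = q ^ (n - k) * gauss q n k + gauss q n (Suc k)"
proof (induction n arbitrary: k)
  case (Suc n)
  show ?case
  proof (cases k)
    case 0
    have "gauss q (Suc (Suc n)) (Suc 0) = 1 + q * gauss q (Suc n) (Suc 0)"
      by simp
    also have "gauss q (Suc n) (Suc 0) = q ^ n + gauss q n (Suc 0)"
      using Suc.IH[of 0] by simp
    finally show ?thesis using 0 by (simp add: algebra_simps)
  next
    case (Suc j)
    show ?thesis
    proof (cases "j = n")
      case False
      then have jn: "Suc j \<le> n" using Suc Suc.prems by simp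
      have 1: "gauss q (Suc n) (Suc j) = q ^ (n - j) * gauss q n j + gauss q n (Suc j)"
        using Suc.IH[of j] jn by simp
      have 2: "gauss q (Suc n) (Suc (Suc j)) = q ^ (n - Suc j) * gauss q n (Suc j) + gauss q n (Suc (Suc j))"
        using Suc.IH[of "Suc j"] jn by simp
      have 3: "q ^ Suc (Suc j) * q ^ (n - Suc j) = q ^ (n - j) * q ^ Suc j"
        using jn by (simp flip: power_add power_Suc)
      have "gauss q (Suc (Suc n)) (Suc (Suc j))
        = gauss q (Suc n) (Suc j) + q ^ Suc (Suc j) * gauss q (Suc n) (Suc (Suc j))"
        by (rule gauss.simps(3))
      also have "\<dots> = q ^ (n - j) * gauss q n j + gauss q n (Suc j)
          + ((q ^ Suc (Suc j) * q ^ (n - Suc j)) * gauss q n (Suc j)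
             + q ^ Suc (Suc j) * gauss q n (Suc (Suc j)))"
        unfolding 1 2 by (simp add: algebra_simps)
      also have "\<dots> = q ^ (n - j) * (gauss q n j + q ^ Suc j * gauss q n (Suc j))
          + (gauss q n (Suc j) + q ^ Suc (Suc j) * gauss q n (Suc (Suc j)))"
        unfolding 3 by (simp add: algebra_simps)
      finally show ?thesis using Suc by simp
    qed (use Suc in \<open>simp add: gauss_eq_0\<close>)
  qed
qed simp

lemma qpoch_0 [simp]: "qpoch x q 0 = 1"
  by (simp add: qpoch_def)

lemma qpoch_Suc: "qpoch x q (Suc n) = qpoch x q n * (1 - x * q ^ n)"
  by (simp add: qpoch_def)

text \<open>The factorial quotient with denominators cleared. Since \<open>gauss\<close> comes from
  a recursion and is a polynomial in q, this and the other identities of the section hold for every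
  q; \<open>norm q < 1\<close> enters only when dividing.\<close>

lemma gauss_mult_qpoch:
  "k \<le> n \<Longrightarrow> gauss q n k * (qpoch q q k * qpoch q q (n - k)) = qpoch q q n"
proof (induction n arbitrary: k)
  case (Suc n)
  show ?case
  proof (cases k)
    case (Suc j)
    show ?thesis
    proof (cases "j = n")
      case False
      then have jn: "j < n" using Suc Suc.prems by simp
      have e: "n - j = Suc (n - Suc j)" using jn by simp
      have "gauss q (Suc n) (Suc j) * (qpoch q q (Suc j) * qpoch q q (n - j))
         = (1 - q ^ Suc j) * (gauss q n j * (qpoch q q j * qpoch q q (n - j)))
         + q ^ Suc j * (1 - q ^ (n - j)) * (gauss q n (Suc j) * (qpoch q q (Suc j) * qpoch q q (n - Suc j)))"
        unfolding gauss.simps(3) e qpoch_Suc by (simp add: algebra_simps)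
      also have "\<dots> = ((1 - q ^ Suc j) + q ^ Suc j * (1 - q ^ (n - j))) * qpoch q q n"
        using Suc.IH[of j] Suc.IH[of "Suc j"] jn by (simp add: algebra_simps)
      also have "(1 - q ^ Suc j) + q ^ Suc j * (1 - q ^ (n - j)) = 1 - q ^ (Suc j + (n - j))"
        by (simp add: algebra_simps power_add)
      also have "Suc j + (n - j) = Suc n" using jn by simp
      finally show ?thesis using Suc by (simp add: qpoch_Suc)
    qed (use Suc in auto)
  qed auto
qed simp

text \<open>Induction on P for all d: the second q-Pascal rule splits [P+1; k], and the shifted half
  is q^(P+d+1) times the sum for d + 1. The two halves recombine by the first rule.\<close>

lemma q_vandermonde:
  "(\<Sum>k\<le>P. q ^ (k * (k + d)) * gauss q P k * gauss q Q (k + d)) = gauss q (P + Q) (P + d)"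
proof (induction P arbitrary: d)
  case (Suc P)
  have split: "gauss q (Suc P) k = gauss q P k + (if k = 0 then 0 else q ^ (Suc P - k) * gauss q P (k - 1))"
    if "k \<le> Suc P" for k
    using that gauss_Suc_Suc'[of "k - 1" P q] by (cases k) auto
  have "(\<Sum>k\<le>Suc P. q ^ (k * (k + d)) * gauss q (Suc P) k * gauss q Q (k + d))
      = (\<Sum>k\<le>Suc P. q ^ (k * (k + d)) * gauss q P k * gauss q Q (k + d)
         + (if k = 0 then 0 else q ^ (k * (k + d)) * q ^ (Suc P - k) * gauss q P (k - 1) * gauss q Q (k + d)))"
    by (intro sum.cong refl) (auto simp: split algebra_simps)
  also have "\<dots> = (\<Sum>k\<le>Suc P. q ^ (k * (k + d)) * gauss q P k * gauss q Q (k + d))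
       + (\<Sum>k\<le>Suc P. if k = 0 then 0 else q ^ (k * (k + d)) * q ^ (Suc P - k) * gauss q P (k - 1) * gauss q Q (k + d))"
    by (rule sum.distrib)
  also have "(\<Sum>k\<le>Suc P. q ^ (k * (k + d)) * gauss q P k * gauss q Q (k + d)) = gauss q (P + Q) (P + d)"
    by (simp add: gauss_eq_0 Suc.IH)
  also have "(\<Sum>k\<le>Suc P. if k = 0 then 0 else q ^ (k * (k + d)) * q ^ (Suc P - k) * gauss q P (k - 1) * gauss q Q (k + d))
     = (\<Sum>k\<le>P. q ^ (Suc k * (Suc k + d)) * q ^ (P - k) * gauss q P k * gauss q Q (Suc k + d))"
    unfolding sum.atMost_Suc_shift by simp
  also have "\<dots> = (\<Sum>k\<le>P. q ^ Suc (P + d) * (q ^ (k * (k + Suc d)) * gauss q P k * gauss q Q (k + Suc d)))"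
  proof (intro sum.cong refl)
    fix k assume "k \<in> {..P}"
    then have "Suc k * (Suc k + d) + (P - k) = Suc (P + d) + k * (k + Suc d)"
      by (simp add: algebra_simps)
    then have "q ^ (Suc k * (Suc k + d)) * q ^ (P - k) = q ^ Suc (P + d) * q ^ (k * (k + Suc d))"
      by (simp only: power_add [symmetric])
    then show "q ^ (Suc k * (Suc k + d)) * q ^ (P - k) * gauss q P k * gauss q Q (Suc k + d)
      = q ^ Suc (P + d) * (q ^ (k * (k + Suc d)) * gauss q P k * gauss q Q (k + Suc d))"
      by (simp only: mult.assoc [symmetric] add_Suc_shift)
  qed
  also have "\<dots> = q ^ Suc (P + d) * gauss q (P + Q) (P + Suc d)"
    unfolding sum_distrib_left [symmetric] Suc.IH ..
  finally show ?case by simp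
qed simp

text \<open>The q-Vandermonde sum with the complementary power of q, in whose proof the two q-Pascal
  rules exchange their roles. The truncated \<open>Q - (k + d)\<close> does no harm, since the last
  factor vanishes for k + d > Q.\<close>

lemma q_vandermonde':
  "(\<Sum>k\<le>P. q ^ ((P - k) * (Q - (k + d))) * gauss q P k * gauss q Q (k + d)) = gauss q (P + Q) (P + d)"
proof (induction P arbitrary: d)
  case (Suc P)
  have split: "gauss q (Suc P) k = q ^ k * gauss q P k + (if k = 0 then 0 else gauss q P (k - 1))"
    if "k \<le> Suc P" for k
    using that by (cases k) auto
  have "(\<Sum>k\<le>Suc P. q ^ ((Suc P - k) * (Q - (k + d))) * gauss q (Suc P) k * gauss q Q (k + d))
      = (\<Sum>k\<le>Suc P. q ^ ((Suc P - k) * (Q - (k + d))) * q ^ k * gauss q P k * gauss q Q (k + d)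
         + (if k = 0 then 0 else q ^ ((Suc P - k) * (Q - (k + d))) * gauss q P (k - 1) * gauss q Q (k + d)))"
    by (intro sum.cong refl) (auto simp: split algebra_simps)
  also have "\<dots> = (\<Sum>k\<le>Suc P. q ^ ((Suc P - k) * (Q - (k + d))) * q ^ k * gauss q P k * gauss q Q (k + d))
       + (\<Sum>k\<le>Suc P. if k = 0 then 0 else q ^ ((Suc P - k) * (Q - (k + d))) * gauss q P (k - 1) * gauss q Q (k + d))"
    by (rule sum.distrib)
  also have "(\<Sum>k\<le>Suc P. if k = 0 then 0 else q ^ ((Suc P - k) * (Q - (k + d))) * gauss q P (k - 1) * gauss q Q (k + d))
     = (\<Sum>k\<le>P. q ^ ((P - k) * (Q - (k + Suc d))) * gauss q P k * gauss q Q (k + Suc d))"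
    unfolding sum.atMost_Suc_shift by simp
  also have "\<dots> = gauss q (P + Q) (P + Suc d)" by (rule Suc.IH)
  also have "(\<Sum>k\<le>Suc P. q ^ ((Suc P - k) * (Q - (k + d))) * q ^ k * gauss q P k * gauss q Q (k + d))
    = (\<Sum>k\<le>P. q ^ ((Suc P - k) * (Q - (k + d))) * q ^ k * gauss q P k * gauss q Q (k + d))"
    by (simp add: gauss_eq_0)
  also have "\<dots> = (\<Sum>k\<le>P. q ^ (Q - d) * (q ^ ((P - k) * (Q - (k + d))) * gauss q P k * gauss q Q (k + d)))"
  proof (intro sum.cong refl)
    fix k assume k: "k \<in> {..P}"
    show "q ^ ((Suc P - k) * (Q - (k + d))) * q ^ k * gauss q P k * gauss q Q (k + d)
      = q ^ (Q - d) * (q ^ ((P - k) * (Q - (k + d))) * gauss q P k * gauss q Q (k + d))"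
    proof (cases "k + d \<le> Q")
      case True
      then have "(Suc P - k) * (Q - (k + d)) + k = (Q - d) + (P - k) * (Q - (k + d))"
        using k by (simp add: Suc_diff_le)
      then have "q ^ ((Suc P - k) * (Q - (k + d))) * q ^ k = q ^ (Q - d) * q ^ ((P - k) * (Q - (k + d)))"
        by (simp only: power_add [symmetric])
      then show ?thesis by (simp add: mult.assoc)
    qed (simp add: gauss_eq_0)
  qed
  also have "\<dots> = q ^ (Q - d) * gauss q (P + Q) (P + d)"
    unfolding sum_distrib_left [symmetric] Suc.IH ..
  finally have eq: "(\<Sum>k\<le>Suc P. q ^ ((Suc P - k) * (Q - (k + d))) * gauss q (Suc P) k * gauss q Q (k + d))
    = q ^ (Q - d) * gauss q (P + Q) (P + d) + gauss q (P + Q) (P + Suc d)" .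
  \<comment> \<open>The second rule is available only for d <= Q; beyond that every entry is
    0.\<close>
  show ?case
  proof (cases "d \<le> Q")
    case True
    then show ?thesis using gauss_Suc_Suc'[of "P + d" "P + Q" q] unfolding eq by simp
  next
    case False
    then show ?thesis unfolding eq by (simp add: gauss_eq_0)
  qed
qed simp

lemma triangle_Suc: "Suc k * (Suc k - 1) div 2 = k * (k - 1) div 2 + k"
proof -
  have "Suc k * (Suc k - 1) = k * (k - 1) + k * 2" by (cases k) auto
  then show ?thesis by simp
qed

text \<open>The new factor 1 - x q^n calls for the second q-Pascal rule, whose power q^(n-k) turns
  the triangular exponent of k + 1 into that of k plus n.\<close>

lemma q_binomial_theorem:
  "qpoch x q n = (\<Sum>k\<le>n. (-1) ^ k * q ^ (k * (k - 1) div 2) * gauss q n k * x ^ k)"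
proof (induction n)
  case (Suc n)
  define t where "t k = (-1) ^ k * q ^ (k * (k - 1) div 2) * gauss q n k * x ^ k" for k
  have "(\<Sum>k\<le>Suc n. (-1) ^ k * q ^ (k * (k - 1) div 2) * gauss q (Suc n) k * x ^ k)
     = 1 + (\<Sum>k\<le>n. (-1) ^ Suc k * q ^ (Suc k * (Suc k - 1) div 2) * gauss q (Suc n) (Suc k) * x ^ Suc k)"
    unfolding sum.atMost_Suc_shift by simp
  also have "(\<Sum>k\<le>n. (-1) ^ Suc k * q ^ (Suc k * (Suc k - 1) div 2) * gauss q (Suc n) (Suc k) * x ^ Suc k)
     = (\<Sum>k\<le>n. t (Suc k) - x * q ^ n * t k)"
  proof (intro sum.cong refl)
    fix k assume "k \<in> {..n}"
    then have k: "k \<le> n" by simp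
    then have "q ^ (Suc k * (Suc k - 1) div 2) * q ^ (n - k) = q ^ (k * (k - 1) div 2) * q ^ n"
      unfolding triangle_Suc by (simp flip: power_add)
    then show "(-1) ^ Suc k * q ^ (Suc k * (Suc k - 1) div 2) * gauss q (Suc n) (Suc k) * x ^ Suc k
      = t (Suc k) - x * q ^ n * t k"
      unfolding t_def gauss_Suc_Suc'[OF k] by (simp add: algebra_simps)
  qed
  also have "\<dots> = (\<Sum>k\<le>n. t (Suc k)) - x * q ^ n * (\<Sum>k\<le>n. t k)"
    by (simp add: sum_subtractf sum_distrib_left)
  also have "1 + \<dots> = (\<Sum>k\<le>Suc n. t k) - x * q ^ n * (\<Sum>k\<le>n. t k)"
    unfolding sum.atMost_Suc_shift by (simp add: t_def)
  also have "(\<Sum>k\<le>Suc n. t k) = (\<Sum>k\<le>n. t k)"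
    by (simp add: t_def gauss_eq_0)
  finally show ?case
    using Suc by (simp add: qpoch_Suc t_def algebra_simps)
qed simp

section \<open>Burge's transformation\<close>

text \<open>Only meaningful for \<open>d \<le> b\<close> and \<open>n \<le> m\<close>: the guard \<open>b \<le> n\<close> then makes both truncated
  subtractions exact.\<close>

definition burge_prod :: "complex \<Rightarrow> nat \<Rightarrow> nat \<Rightarrow> nat \<Rightarrow> nat \<Rightarrow> complex" where
  "burge_prod q m n d b =
     (if b \<le> n then gauss q (m - d) (n - b) * gauss q (m + d) (n + b) else 0)"

text \<open>A Bailey pair relative to 1 consists of sequences alpha, beta with beta_n = sum_j
  alpha_j \<open>bailey_ker q n j\<close>.\<close>

definition bailey_ker :: "complex \<Rightarrow> nat \<Rightarrow> nat \<Rightarrow> complex" where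
  "bailey_ker q n j = (if j \<le> n then 1 / (qpoch q q (n - j) * qpoch q q (n + j)) else 0)"

text \<open>The terms of index \<open>j\<close> and \<open>- j\<close> of the bilateral sums in the literature are combined, here
  and in \<open>jacobi_term\<close> below.\<close>

definition unit_alpha :: "complex \<Rightarrow> nat \<Rightarrow> complex" where
  "unit_alpha q j = (if j = 0 then 1 else (-1) ^ j * q ^ (j * (j - 1) div 2) * (1 + q ^ j))"

text \<open>What summing over the last t variables leaves behind, as a function of the two variables
  m, n just before them; the start [m; n] is the last factor of \<open>summand\<close>.\<close>

fun burge_iter :: "complex \<Rightarrow> nat \<Rightarrow> nat \<Rightarrow> nat \<Rightarrow> complex" where
  "burge_iter q 0 m n = gauss q m n"
| "burge_iter q (Suc t) m n =
     (\<Sum>i\<le>n. q ^ i\<^sup>2 * gauss q (m + n - i) (2 * n) * burge_iter q t n i)"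

text \<open>Reindexing by i = k + b. P may exceed L - b, and b may exceed L, so that no application
  has to treat short ranges separately.\<close>

lemma sum_atMost_shift_neutral:
  fixes f h :: "nat \<Rightarrow> 'a::comm_monoid_add"
  assumes "\<And>i. i < b \<Longrightarrow> f i = 0" "\<And>k. L < k + b \<Longrightarrow> h k = 0"
    and "\<And>k. k + b \<le> L \<Longrightarrow> f (k + b) = h k" "L \<le> P + b"
  shows "sum f {..L} = sum h {..P}"
proof -
  have "sum f {..L} = sum f {b..L}"
    using assms(1) by (intro sum.mono_neutral_right) auto
  also have "\<dots> = sum h {k. k + b \<le> L}"
    by (rule sum.reindex_bij_witness[where i = "\<lambda>k. k + b" and j = "\<lambda>i. i - b"])
       (auto simp flip: assms(3))
  also have "\<dots> = sum h {..P}"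
    using assms(2,4) by (intro sum.mono_neutral_left) (auto simp: not_le)
  finally show ?thesis .
qed

text \<open>The substitution i = k + b turns i^2 into b^2 + k (k + 2b), the exponent of the
  q-Vandermonde sum with shift 2b. The weight c serves both \<open>burge_transform\<close> and its
  limit, where c = 1.\<close>

lemma sum_burge_prod_shift:
  assumes "d \<le> b" "d \<le> L"
  shows "(\<Sum>i\<le>L. q ^ i\<^sup>2 * c i * burge_prod q L i d b)
     = q ^ b\<^sup>2 * (\<Sum>k\<le>L - d. q ^ (k * (k + 2 * b)) * c (k + b) * gauss q (L - d) k * gauss q (L + d) (k + 2 * b))"
proof -
  have "(\<Sum>i\<le>L. q ^ i\<^sup>2 * c i * burge_prod q L i d b)
     = (\<Sum>k\<le>L - d. q ^ (b\<^sup>2 + k * (k + 2 * b)) * c (k + b) * gauss q (L - d) k * gauss q (L + d) (k + 2 * b))"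
  proof (rule sum_atMost_shift_neutral[where b = b])
    fix k assume "L < k + b"
    then have "L + d < k + 2 * b" using assms by auto
    then show "q ^ (b\<^sup>2 + k * (k + 2 * b)) * c (k + b) * gauss q (L - d) k * gauss q (L + d) (k + 2 * b) = 0"
      by (simp add: gauss_eq_0)
  next
    fix k
    have "b\<^sup>2 + k * (k + 2 * b) = (k + b)\<^sup>2" by (simp add: power2_eq_square algebra_simps)
    then show "q ^ (k + b)\<^sup>2 * c (k + b) * burge_prod q L (k + b) d b
      = q ^ (b\<^sup>2 + k * (k + 2 * b)) * c (k + b) * gauss q (L - d) k * gauss q (L + d) (k + 2 * b)"
      by (simp add: burge_prod_def mult.assoc add.assoc mult_2)
  qed (use assms in \<open>auto simp: burge_prod_def\<close>)
  then show ?thesis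
    by (simp add: sum_distrib_left power_add mult.assoc)
qed

lemma sum_burge_prod_eq_0:
  assumes "d \<le> b" "L < d"
  shows "(\<Sum>i\<le>L. q ^ i\<^sup>2 * c i * burge_prod q L i d b) = 0"
  using assms by (intro sum.neutral) (auto simp: burge_prod_def)

lemma burge_iter_eq_0: "n > m \<Longrightarrow> burge_iter q t m n = 0"
  by (cases t) (auto simp: gauss_eq_0 intro!: sum.neutral)

context
  fixes q :: complex
  assumes q: "norm q < 1"
begin

lemma one_minus_power_nonzero: "n > 0 \<Longrightarrow> 1 - q ^ n \<noteq> 0"
proof
  assume n: "n > 0" and "1 - q ^ n = 0"
  then have "norm q ^ n = 1" by (metis eq_iff_diff_eq_0 norm_one norm_power)
  moreover have "norm q ^ n < 1" using q n by (simp add: power_less_one_iff)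
  ultimately show False by simp
qed

lemma qpoch_nonzero [simp]: "qpoch q q n \<noteq> 0"
  using one_minus_power_nonzero[of "Suc _"] by (auto simp: qpoch_def)

lemma gauss_eq:
  "gauss q n k = (if k \<le> n then qpoch q q n / (qpoch q q k * qpoch q q (n - k)) else 0)"
  using gauss_mult_qpoch[of k n q] by (auto simp: gauss_eq_0 field_simps)

lemma gauss_add: "gauss q (m + n) m = qpoch q q (m + n) / (qpoch q q m * qpoch q q n)"
  by (simp add: gauss_eq)

lemma qbinom_eq_gauss: "qbinom q (int n) (int k) = gauss q n k"
  by (auto simp: qbinom_def gauss_eq nat_diff_distrib)

text \<open>The factor [P+Q+M-k; P+Q] is expanded by q-Vandermonde; for fixed s = k + l the sum over
  k is the complementary q-Vandermonde sum, and what remains is a third q-Vandermonde sum over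
  s.\<close>

lemma q_saalschuetz:
  "(\<Sum>k\<le>P. q ^ (k * (k + d)) * gauss q (P + Q + M - k) (P + Q) * gauss q P k * gauss q Q (k + d))
   = gauss q (M + P + d) M * gauss q (M + Q) (M + d)"
proof -
  have expand: "gauss q (P + Q + M - k) (P + Q)
     = (\<Sum>l\<le>P - k. q ^ (l * (l + (Q + k))) * gauss q (P - k) l * gauss q (Q + M) (l + (Q + k)))"
    if "k \<le> P" for k
  proof -
    have "P - k + (Q + M) = P + Q + M - k" "P - k + (Q + k) = P + Q" using that by auto
    then show ?thesis by (simp only: q_vandermonde)
  qed
  define g where "g k l = q ^ (k * (k + d)) * gauss q P k * gauss q Q (k + d) *
    (q ^ (l * (l + (Q + k))) * gauss q (P - k) l * gauss q (Q + M) (l + (Q + k)))" for k l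
  have "(\<Sum>k\<le>P. q ^ (k * (k + d)) * gauss q (P + Q + M - k) (P + Q) * gauss q P k * gauss q Q (k + d))
      = (\<Sum>k\<le>P. \<Sum>l\<le>P - k. g k l)"
  proof (intro sum.cong refl)
    fix k assume "k \<in> {..P}"
    then have k: "k \<le> P" by simp
    show "q ^ (k * (k + d)) * gauss q (P + Q + M - k) (P + Q) * gauss q P k * gauss q Q (k + d) = (\<Sum>l\<le>P - k. g k l)"
      unfolding g_def sum_distrib_left [symmetric] expand[OF k] by (simp only: mult_ac)
  qed
  also have "\<dots> = (\<Sum>(k, l) | k + l \<le> P. g k l)"
    by (subst sum.Sigma) (auto intro!: sum.cong)
  also have "\<dots> = (\<Sum>s\<le>P. \<Sum>k\<le>s. g k (s - k))"
    by (rule sum.triangle_reindex_eq)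
  also have "\<dots> = (\<Sum>s\<le>P. q ^ (s * (s + d)) * gauss q P s * gauss q (Q + M) (s + Q) * gauss q (s + Q) (s + d))"
  proof (intro sum.cong refl)
    fix s assume "s \<in> {..P}"
    then have s: "s \<le> P" by simp
    have "(\<Sum>k\<le>s. g k (s - k)) = (\<Sum>k\<le>s. (q ^ (s * (s + d)) * gauss q P s * gauss q (Q + M) (s + Q)) *
        (q ^ ((s - k) * (Q - (k + d))) * gauss q s k * gauss q Q (k + d)))"
    proof (intro sum.cong refl)
      fix k assume "k \<in> {..s}"
      then have k: "k \<le> s" by simp
      \<comment> \<open>Trinomial revision: the dependence on P moves out of the sum over k.\<close>
      have tri: "gauss q P k * gauss q (P - k) (s - k) = gauss q P s * gauss q s k"
        using k s by (simp add: gauss_eq field_simps)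
      show "g k (s - k) = (q ^ (s * (s + d)) * gauss q P s * gauss q (Q + M) (s + Q)) *
        (q ^ ((s - k) * (Q - (k + d))) * gauss q s k * gauss q Q (k + d))"
      \<comment> \<open>The exponent identity needs Q - (k + d) as a true difference; otherwise
        [Q; k+d] = 0.\<close>
      proof (cases "k + d \<le> Q")
        case True
        obtain u v where uv: "s = k + u" "Q = k + d + v"
          using k True by (metis le_Suc_ex)
        have "k * (k + d) + (s - k) * (s - k + (Q + k)) = s * (s + d) + (s - k) * (Q - (k + d))"
          unfolding uv by (simp add: algebra_simps)
        then have e: "q ^ (k * (k + d)) * q ^ ((s - k) * (s - k + (Q + k)))
            = q ^ (s * (s + d)) * q ^ ((s - k) * (Q - (k + d)))"
          by (simp only: power_add [symmetric])
        have f: "s - k + (Q + k) = s + Q" using k by simp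
        have "g k (s - k) = (q ^ (k * (k + d)) * q ^ ((s - k) * (s - k + (Q + k)))) *
           (gauss q P k * gauss q (P - k) (s - k)) * gauss q Q (k + d) * gauss q (Q + M) (s - k + (Q + k))"
          unfolding g_def by (simp only: mult_ac)
        then show ?thesis
          unfolding e tri unfolding f by (simp only: mult_ac)
      qed (simp add: g_def gauss_eq_0)
    qed
    also have "\<dots> = q ^ (s * (s + d)) * gauss q P s * gauss q (Q + M) (s + Q) * gauss q (s + Q) (s + d)"
      unfolding sum_distrib_left [symmetric] q_vandermonde' ..
    finally show "(\<Sum>k\<le>s. g k (s - k)) = \<dots>" .
  qed
  also have "\<dots> = (\<Sum>s\<le>P. (q ^ (s * (s + d)) * gauss q P s * gauss q (M + d) (s + d)) * gauss q (M + Q) (M + d))"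
  proof (intro sum.cong refl)
    fix s
    \<comment> \<open>Both sides are the q-trinomial coefficient of M + Q with parts M - s, s + d
      and Q - d; on the right only the first factor contains s.\<close>
    have "gauss q (Q + M) (s + Q) * gauss q (s + Q) (s + d) = gauss q (M + d) (s + d) * gauss q (M + Q) (M + d)"
    proof (cases "s \<le> M \<and> d \<le> Q")
      case True
      then show ?thesis
        by (simp add: gauss_eq field_simps)
    qed (auto simp: gauss_eq_0)
    then show "q ^ (s * (s + d)) * gauss q P s * gauss q (Q + M) (s + Q) * gauss q (s + Q) (s + d)
       = (q ^ (s * (s + d)) * gauss q P s * gauss q (M + d) (s + d)) * gauss q (M + Q) (M + d)"
      by (simp only: mult_ac)
  qed
  also have "\<dots> = gauss q (P + (M + d)) (P + d) * gauss q (M + Q) (M + d)"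
    unfolding sum_distrib_right [symmetric] q_vandermonde ..
  also have "gauss q (P + (M + d)) (P + d) = gauss q (M + P + d) M"
    by (simp add: gauss_eq ac_simps)
  finally show ?thesis .
qed

text \<open>After the shift this is \<open>q_saalschuetz\<close> with P = L - d, Q = L + d, shift
  2b, and M - (L + b) in place of M. That difference has to be a natural number, hence the case
  split; outside it both sides vanish.\<close>

lemma burge_transform:
  assumes "d \<le> b"
  shows "(\<Sum>i\<le>L. q ^ i\<^sup>2 * gauss q (M + L - i) (2 * L) * burge_prod q L i d b)
     = q ^ b\<^sup>2 * burge_prod q M L (b - d) (2 * b - d)"
proof (cases "L + b \<le> M \<and> d \<le> L")
  case True
  define M' where "M' = M - (L + b)"
  have M: "M = M' + L + b" using True by (simp add: M'_def)
  have "(\<Sum>i\<le>L. q ^ i\<^sup>2 * gauss q (M + L - i) (2 * L) * burge_prod q L i d b)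
     = q ^ b\<^sup>2 * (\<Sum>k\<le>L - d. q ^ (k * (k + 2 * b)) * gauss q (M + L - (k + b)) (2 * L) *
          gauss q (L - d) k * gauss q (L + d) (k + 2 * b))"
    by (rule sum_burge_prod_shift) (use True assms in auto)
  also have "(\<Sum>k\<le>L - d. q ^ (k * (k + 2 * b)) * gauss q (M + L - (k + b)) (2 * L) *
          gauss q (L - d) k * gauss q (L + d) (k + 2 * b))
      = (\<Sum>k\<le>L - d. q ^ (k * (k + 2 * b)) * gauss q ((L - d) + (L + d) + M' - k) ((L - d) + (L + d)) *
          gauss q (L - d) k * gauss q (L + d) (k + 2 * b))"
  proof -
    have *: "M + L - (k + b) = (L - d) + (L + d) + M' - k" "2 * L = (L - d) + (L + d)" for k
      using True unfolding M by auto
    show ?thesis unfolding * ..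
  qed
  also have "\<dots> = gauss q (M' + (L - d) + 2 * b) M' * gauss q (M' + (L + d)) (M' + 2 * b)"
    by (rule q_saalschuetz)
  also have "\<dots> = burge_prod q M L (b - d) (2 * b - d)"
  proof (cases "2 * b - d \<le> L")
    case True
    define x where "x = L + (2 * b - d)"
    define y where "y = L - (2 * b - d)"
    have *: "M' + (L - d) + 2 * b = M' + x" "M + (b - d) = x + M'"
      "M' + (L + d) = (M' + 2 * b) + y" "M - (b - d) = y + (M' + 2 * b)"
      using \<open>L + b \<le> M \<and> d \<le> L\<close> assms True unfolding M x_def y_def by auto
    \<comment> \<open>The symmetry of the Gaussian binomial, read off from \<open>gauss_add\<close>,
      brings the lower entries into the form of \<open>burge_prod\<close>.\<close>
    have "gauss q (M' + x) M' = gauss q (x + M') x"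
      "gauss q ((M' + 2 * b) + y) (M' + 2 * b) = gauss q (y + (M' + 2 * b)) y"
      unfolding gauss_add by (simp_all only: ac_simps)
    then show ?thesis using True unfolding burge_prod_def x_def [symmetric] y_def [symmetric] *
      by (simp only: mult.commute if_True)
  next
    case False
    then show ?thesis by (simp add: burge_prod_def gauss_eq_0)
  qed
  finally show ?thesis .
next
  case False
  have "burge_prod q M L (b - d) (2 * b - d) = 0"
    using False assms by (auto simp: burge_prod_def gauss_eq_0)
  moreover have "(\<Sum>i\<le>L. q ^ i\<^sup>2 * gauss q (M + L - i) (2 * L) * burge_prod q L i d b) = 0"
  proof (cases "d \<le> L")
    case True
    then have "M < L + b" using False by simp
    then show ?thesis
      by (intro sum.neutral) (auto simp: burge_prod_def gauss_eq_0)
  next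
    case False
    then show ?thesis using assms by (intro sum_burge_prod_eq_0) auto
  qed
  ultimately show ?thesis by simp
qed

text \<open>The case M -> infinity, multiplied by (q)_{2L}: the weight becomes 1 and q-Vandermonde
  takes the place of q-Saalschuetz.\<close>

lemma burge_transform_limit:
  assumes "d \<le> b"
  shows "(\<Sum>i\<le>L. q ^ i\<^sup>2 * burge_prod q L i d b)
     = q ^ b\<^sup>2 * qpoch q q (2 * L) * bailey_ker q L (2 * b - d)"
proof (cases "d \<le> L")
  case True
  have "(\<Sum>i\<le>L. q ^ i\<^sup>2 * burge_prod q L i d b)
     = q ^ b\<^sup>2 * (\<Sum>k\<le>L - d. q ^ (k * (k + 2 * b)) * gauss q (L - d) k * gauss q (L + d) (k + 2 * b))"
    using sum_burge_prod_shift[OF assms True, where c = "\<lambda>_. 1" and q = q] by simp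
  also have "\<dots> = q ^ b\<^sup>2 * gauss q (2 * L) (L + (2 * b - d))"
    unfolding q_vandermonde using True assms by (simp add: mult_2)
  also have "gauss q (2 * L) (L + (2 * b - d)) = qpoch q q (2 * L) * bailey_ker q L (2 * b - d)"
    using assms by (auto simp: bailey_ker_def gauss_eq)
  finally show ?thesis by (simp add: mult.assoc)
next
  case False
  then show ?thesis
    using sum_burge_prod_eq_0[OF assms, where L = L and c = "\<lambda>_. 1" and q = q] assms by (simp add: bailey_ker_def)
qed

section \<open>The unit Bailey pair and the starting expansion\<close>

lemma unit_bailey_pair_aux:
  "J < r \<Longrightarrow> (\<Sum>j\<le>J. unit_alpha q j * bailey_ker q r j)
     = (-1) ^ J * q ^ (Suc J * (Suc J - 1) div 2) / (qpoch q q (r - Suc J) * qpoch q q (r + J) * (1 - q ^ r))"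
proof (induction J)
  case 0
  then obtain s where s: "r = Suc s" using gr0_implies_Suc by blast
  show ?case by (simp add: s unit_alpha_def bailey_ker_def qpoch_Suc)
next
  case (Suc J)
  then obtain s where s: "r = Suc (Suc (J + s))"
    using less_imp_Suc_add[of "Suc J" r] by auto
  define T where "T = Suc J * (Suc J - 1) div 2"
  have T: "Suc (Suc J) * (Suc (Suc J) - 1) div 2 = T + Suc J"
    unfolding T_def by (rule triangle_Suc)
  define A where "A = qpoch q q s"
  define B where "B = qpoch q q (r + J)"
  define x where "x = 1 - q ^ Suc s"
  define y where "y = 1 - q ^ Suc (r + J)"
  define z where "z = 1 - q ^ r"
  have nz: "A \<noteq> 0" "B \<noteq> 0" "x \<noteq> 0" "y \<noteq> 0" "z \<noteq> 0"
    using s one_minus_power_nonzero[of "Suc s"] one_minus_power_nonzero[of "Suc (r + J)"] one_minus_power_nonzero[of r]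
    by (auto simp: A_def B_def x_def y_def z_def)
  \<comment> \<open>Up to a common factor the old partial sum and the new term are y and -(1 +
    q^(J+1)) z; this cancellation makes the partial sums telescope.\<close>
  have key: "y - (1 + q ^ Suc J) * z = - (q ^ Suc J * x)"
    unfolding x_def y_def z_def s by (simp add: algebra_simps power_add)
  have "(\<Sum>j\<le>Suc J. unit_alpha q j * bailey_ker q r j)
    = (-1) ^ J * q ^ T / (A * x * B * z) + (-1) ^ Suc J * q ^ T * (1 + q ^ Suc J) * (1 / (A * x * (B * y)))"
  proof -
    have "qpoch q q (r - Suc J) = A * x"
      by (simp add: s A_def x_def qpoch_Suc)
    moreover have "qpoch q q (r + Suc J) = B * y"
      by (simp add: B_def y_def qpoch_Suc)
    ultimately show ?thesis
      using Suc by (simp add: B_def z_def T_def unit_alpha_def bailey_ker_def)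
  qed
  also have "\<dots> = (-1) ^ J * q ^ T / (A * x * B * y * z) * (y - (1 + q ^ Suc J) * z)"
    using nz by (simp add: field_simps)
  also have "\<dots> = (-1) ^ Suc J * q ^ (T + Suc J) / (A * (B * y) * z)"
    unfolding key using nz by (simp add: field_simps power_add)
  also have "\<dots> = (-1) ^ Suc J * q ^ (Suc (Suc J) * (Suc (Suc J) - 1) div 2) /
      (qpoch q q (r - Suc (Suc J)) * qpoch q q (r + Suc J) * (1 - q ^ r))"
    unfolding T by (simp add: s A_def B_def y_def z_def qpoch_Suc)
  finally show ?case .
qed

text \<open>The closed form of the partial sums at J = r - 1 is the negative of the last term, whose
  denominator (q)_{2r} supplies 1 - q^(2r) = (1 - q^r)(1 + q^r).\<close>

lemma unit_bailey_pair:
  "(\<Sum>j\<le>r. unit_alpha q j * bailey_ker q r j) = (if r = 0 then 1 else 0)"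
proof (cases r)
  case 0
  then show ?thesis by (simp add: unit_alpha_def bailey_ker_def)
next
  case (Suc s)
  define T where "T = Suc s * (Suc s - 1) div 2"
  define B where "B = qpoch q q (r + s)"
  have square: "1 - q ^ (r + r) = (1 - q ^ r) * (1 + q ^ r)"
    by (simp add: power_add algebra_simps)
  have "1 - q ^ (r + r) \<noteq> 0"
    using Suc by (intro one_minus_power_nonzero) simp
  then have nz: "B \<noteq> 0" "1 - q ^ r \<noteq> 0" "1 + q ^ r \<noteq> 0"
    unfolding square by (auto simp: B_def)
  have "qpoch q q (r + r) = B * (1 - q ^ (r + r))"
    by (simp add: Suc B_def qpoch_Suc)
  also note square
  finally have "(\<Sum>j\<le>r. unit_alpha q j * bailey_ker q r j)
    = (-1) ^ s * q ^ T / (B * (1 - q ^ r)) + (-1) ^ r * q ^ T * (1 + q ^ r) / (B * ((1 - q ^ r) * (1 + q ^ r)))"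
    using unit_bailey_pair_aux[of s r] Suc by (simp add: T_def B_def unit_alpha_def bailey_ker_def)
  also have "(-1) ^ r * q ^ T = - ((-1) ^ s * q ^ T)"
    by (simp add: Suc)
  also have "(-1) ^ s * q ^ T / (B * (1 - q ^ r)) +
      - ((-1) ^ s * q ^ T) * (1 + q ^ r) / (B * ((1 - q ^ r) * (1 + q ^ r))) = 0"
    using nz(3) by simp
  finally show ?thesis using Suc by simp
qed

text \<open>A terminating Bailey lemma applied to the unit pair: each q^(j^2) D(m,n;0,j) is a
  weighted sum of kernels over r, and \<open>unit_bailey_pair\<close> keeps only r = 0.\<close>

lemma bailey_seed:
  "(\<Sum>j\<le>n. unit_alpha q j * q ^ j\<^sup>2 * burge_prod q m n 0 j) = gauss q m n"
proof (cases "n \<le> m")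
  case True
  then obtain N where N: "m = n + N" by (metis le_Suc_ex)
  \<comment> \<open>Dictated by q-Vandermonde: with this weight the sum over r has the factors
    [n-j; r-j] and [N+j; r+j]. At r = 0 it equals [m; n].\<close>
  define w where "w r = (if r \<le> N then qpoch q q m / (qpoch q q (n - r) * qpoch q q (N - r)) else 0)" for r
  have ker: "q ^ j\<^sup>2 * burge_prod q m n 0 j = (\<Sum>r\<le>n. q ^ r\<^sup>2 * w r * bailey_ker q r j)"
    if j: "j \<le> n" for j
  proof -
    define c where "c = qpoch q q m / (qpoch q q (n - j) * qpoch q q (N + j))"
    have "(\<Sum>r\<le>n. q ^ r\<^sup>2 * w r * bailey_ker q r j)
       = (\<Sum>k\<le>n - j. (q ^ j\<^sup>2 * c) * (q ^ (k * (k + 2 * j)) * gauss q (n - j) k * gauss q (N + j) (k + 2 * j)))"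
    proof (rule sum_atMost_shift_neutral[where b = j])
      fix k assume k: "k + j \<le> n"
      define r where "r = k + j"
      have "j\<^sup>2 + k * (k + 2 * j) = r\<^sup>2" unfolding r_def by (simp add: power2_eq_square algebra_simps)
      then have e: "q ^ r\<^sup>2 = q ^ j\<^sup>2 * q ^ (k * (k + 2 * j))"
        by (metis power_add)
      show "q ^ (k + j)\<^sup>2 * w (k + j) * bailey_ker q (k + j) j
        = (q ^ j\<^sup>2 * c) * (q ^ (k * (k + 2 * j)) * gauss q (n - j) k * gauss q (N + j) (k + 2 * j))"
      proof (cases "r \<le> N")
        case True
        have sub: "r - j = k" "n - j - k = n - r" "k + 2 * j = r + j" "N + j - (r + j) = N - r"
          "k \<le> n - j" "r + j \<le> N + j"
          using k True by (auto simp: r_def)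
        have "gauss q (n - j) k = qpoch q q (n - j) / (qpoch q q k * qpoch q q (n - r))"
          "gauss q (N + j) (k + 2 * j) = qpoch q q (N + j) / (qpoch q q (r + j) * qpoch q q (N - r))"
          unfolding gauss_eq sub using sub by simp_all
        moreover have "w r = qpoch q q m / (qpoch q q (n - r) * qpoch q q (N - r))"
          "bailey_ker q r j = 1 / (qpoch q q k * qpoch q q (r + j))"
          using True sub by (simp_all add: w_def bailey_ker_def r_def)
        ultimately show ?thesis unfolding r_def [symmetric] e
          by (simp add: c_def mult_ac)
      qed (simp add: r_def w_def gauss_eq_0)
    next
      fix k assume k: "n < k + j"
      then show "(q ^ j\<^sup>2 * c) * (q ^ (k * (k + 2 * j)) * gauss q (n - j) k * gauss q (N + j) (k + 2 * j)) = 0"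
        using j by (simp add: gauss_eq_0)
    qed (use j in \<open>auto simp: bailey_ker_def\<close>)
    also have "\<dots> = q ^ j\<^sup>2 * c * gauss q (n - j + (N + j)) (n - j + 2 * j)"
      unfolding sum_distrib_left [symmetric] q_vandermonde ..
    also have "c = gauss q m (n - j)"
      using j by (simp add: c_def gauss_eq N)
    also have "gauss q (n - j + (N + j)) (n - j + 2 * j) = gauss q m (n + j)"
      using j by (simp add: N ac_simps)
    finally show ?thesis using j by (simp add: burge_prod_def mult.assoc)
  qed
  have "(\<Sum>j\<le>n. unit_alpha q j * q ^ j\<^sup>2 * burge_prod q m n 0 j)
     = (\<Sum>j\<le>n. \<Sum>r\<le>n. q ^ r\<^sup>2 * w r * (unit_alpha q j * bailey_ker q r j))"
  proof (intro sum.cong refl)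
    fix j assume "j \<in> {..n}"
    then show "unit_alpha q j * q ^ j\<^sup>2 * burge_prod q m n 0 j
      = (\<Sum>r\<le>n. q ^ r\<^sup>2 * w r * (unit_alpha q j * bailey_ker q r j))"
      using ker[of j] by (simp add: mult.assoc sum_distrib_left mult.left_commute)
  qed
  also have "\<dots> = (\<Sum>r\<le>n. \<Sum>j\<le>n. q ^ r\<^sup>2 * w r * (unit_alpha q j * bailey_ker q r j))"
    by (rule sum.swap)
  also have "\<dots> = (\<Sum>r\<le>n. if r = 0 then w 0 else 0)"
  proof (intro sum.cong refl)
    fix r assume "r \<in> {..n}"
    then have "(\<Sum>j\<le>n. unit_alpha q j * bailey_ker q r j) = (\<Sum>j\<le>r. unit_alpha q j * bailey_ker q r j)"
      by (intro sum.mono_neutral_right) (auto simp: bailey_ker_def)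
    then show "(\<Sum>j\<le>n. q ^ r\<^sup>2 * w r * (unit_alpha q j * bailey_ker q r j)) = (if r = 0 then w 0 else 0)"
      unfolding sum_distrib_left [symmetric] unit_bailey_pair by simp
  qed
  also have "\<dots> = w 0" by simp
  also have "\<dots> = gauss q m n" by (simp add: w_def N gauss_add)
  finally show ?thesis .
qed (auto simp: burge_prod_def gauss_eq_0)

lemma burge_iter_eq:
  "burge_iter q t m n = (\<Sum>j\<le>n. unit_alpha q j * q ^ (fib (t + 1) * fib (t + 2) * j\<^sup>2) *
     burge_prod q m n (fib t * j) (fib (t + 2) * j))"
proof (induction t arbitrary: m n)
  case 0
  then show ?case by (simp add: bailey_seed)
next
  case (Suc t)
  define e where "e = fib (t + 1) * fib (t + 2)"
  define b where "b = fib (t + 2)"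
  define d where "d = fib t"
  have b: "b > 0" "d \<le> b" "b - d = fib (t + 1)" "2 * b - d = fib (t + 3)"
    by (simp_all add: b_def d_def numeral_3_eq_3 fib_neq_0_nat)
  have "burge_iter q (Suc t) m n
     = (\<Sum>i\<le>n. \<Sum>j\<le>n. unit_alpha q j * q ^ (e * j\<^sup>2) *
          (q ^ i\<^sup>2 * gauss q (m + n - i) (2 * n) * burge_prod q n i (d * j) (b * j)))"
    unfolding burge_iter.simps
  proof (intro sum.cong refl)
    fix i assume i: "i \<in> {..n}"
    \<comment> \<open>For j > i the guard in \<open>burge_prod\<close> fails, since b > 0 gives b *
      j >= j. With the common range up to n the two sums can be exchanged.\<close>
    have "burge_iter q t n i = (\<Sum>j\<le>n. unit_alpha q j * q ^ (e * j\<^sup>2) * burge_prod q n i (d * j) (b * j))"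
      unfolding Suc.IH e_def b_def [symmetric] d_def [symmetric]
    proof (rule sum.mono_neutral_left)
      show "\<forall>j\<in>{..n} - {..i}. unit_alpha q j * q ^ (fib (t + 1) * b * j\<^sup>2) * burge_prod q n i (d * j) (b * j) = 0"
      proof
        fix j assume "j \<in> {..n} - {..i}"
        moreover have "j \<le> b * j" using b by simp
        ultimately have "\<not> b * j \<le> i" by (meson DiffD2 atMost_iff le_trans)
        then show "unit_alpha q j * q ^ (fib (t + 1) * b * j\<^sup>2) * burge_prod q n i (d * j) (b * j) = 0"
          by (simp add: burge_prod_def)
      qed
    qed (use i in auto)
    then show "q ^ i\<^sup>2 * gauss q (m + n - i) (2 * n) * burge_iter q t n i
      = (\<Sum>j\<le>n. unit_alpha q j * q ^ (e * j\<^sup>2) *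
          (q ^ i\<^sup>2 * gauss q (m + n - i) (2 * n) * burge_prod q n i (d * j) (b * j)))"
      by (simp add: sum_distrib_left mult_ac)
  qed
  also have "\<dots> = (\<Sum>j\<le>n. unit_alpha q j * q ^ (e * j\<^sup>2) *
       (\<Sum>i\<le>n. q ^ i\<^sup>2 * gauss q (m + n - i) (2 * n) * burge_prod q n i (d * j) (b * j)))"
    by (subst sum.swap) (simp add: sum_distrib_left)
  also have "\<dots> = (\<Sum>j\<le>n. unit_alpha q j * q ^ (e * j\<^sup>2 + (b * j)\<^sup>2) *
       burge_prod q m n (fib (Suc t) * j) (fib (Suc t + 2) * j))"
  proof (intro sum.cong refl)
    fix j
    have "b * j - d * j = fib (Suc t) * j" "2 * (b * j) - d * j = fib (Suc t + 2) * j"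
      using b(3,4) by (simp_all add: diff_mult_distrib [symmetric] mult.assoc [symmetric] numeral_3_eq_3)
    moreover have "d * j \<le> b * j" using b by simp
    ultimately show "unit_alpha q j * q ^ (e * j\<^sup>2) *
       (\<Sum>i\<le>n. q ^ i\<^sup>2 * gauss q (m + n - i) (2 * n) * burge_prod q n i (d * j) (b * j))
      = unit_alpha q j * q ^ (e * j\<^sup>2 + (b * j)\<^sup>2) *
       burge_prod q m n (fib (Suc t) * j) (fib (Suc t + 2) * j)"
      by (simp only: burge_transform power_add) (simp only: mult_ac)
  qed
  also have "(\<lambda>j. e * j\<^sup>2 + (b * j)\<^sup>2) = (\<lambda>j. fib (Suc t + 1) * fib (Suc t + 2) * j\<^sup>2)"
    by (simp add: e_def b_def power2_eq_square algebra_simps)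
  then have "(\<Sum>j\<le>n. unit_alpha q j * q ^ (e * j\<^sup>2 + (b * j)\<^sup>2) *
       burge_prod q m n (fib (Suc t) * j) (fib (Suc t + 2) * j))
     = (\<Sum>j\<le>n. unit_alpha q j * q ^ (fib (Suc t + 1) * fib (Suc t + 2) * j\<^sup>2) *
       burge_prod q m n (fib (Suc t) * j) (fib (Suc t + 2) * j))"
    by metis
  finally show ?case .
qed

text \<open>The sum over m_3, with L = m_2. No binomial coefficient is left, so the limit form
  applies; the factor (q)_{2L} will cancel 1/(q)_{2 m_2} in \<open>summand\<close>.\<close>

lemma sum_burge_iter:
  "(\<Sum>i\<le>L. q ^ i\<^sup>2 * burge_iter q t L i)
   = qpoch q q (2 * L) * (\<Sum>j\<le>L. unit_alpha q j * q ^ (fib (t + 2) * fib (t + 3) * j\<^sup>2) *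
        bailey_ker q L (fib (t + 3) * j))"
proof -
  define e where "e = fib (t + 1) * fib (t + 2)"
  define b where "b = fib (t + 2)"
  define d where "d = fib t"
  have b: "b > 0" "d \<le> b" "2 * b - d = fib (t + 3)"
    by (simp_all add: b_def d_def numeral_3_eq_3 fib_neq_0_nat)
  have "(\<Sum>i\<le>L. q ^ i\<^sup>2 * burge_iter q t L i)
     = (\<Sum>i\<le>L. \<Sum>j\<le>L. unit_alpha q j * q ^ (e * j\<^sup>2) *
          (q ^ i\<^sup>2 * burge_prod q L i (d * j) (b * j)))"
  proof (intro sum.cong refl)
    fix i assume i: "i \<in> {..L}"
    have "burge_iter q t L i = (\<Sum>j\<le>L. unit_alpha q j * q ^ (e * j\<^sup>2) * burge_prod q L i (d * j) (b * j))"
      unfolding burge_iter_eq e_def b_def [symmetric] d_def [symmetric]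
    proof (rule sum.mono_neutral_left)
      show "\<forall>j\<in>{..L} - {..i}. unit_alpha q j * q ^ (fib (t + 1) * b * j\<^sup>2) * burge_prod q L i (d * j) (b * j) = 0"
      proof
        fix j assume "j \<in> {..L} - {..i}"
        moreover have "j \<le> b * j" using b by simp
        ultimately have "\<not> b * j \<le> i" by (meson DiffD2 atMost_iff le_trans)
        then show "unit_alpha q j * q ^ (fib (t + 1) * b * j\<^sup>2) * burge_prod q L i (d * j) (b * j) = 0"
          by (simp add: burge_prod_def)
      qed
    qed (use i in auto)
    then show "q ^ i\<^sup>2 * burge_iter q t L i
      = (\<Sum>j\<le>L. unit_alpha q j * q ^ (e * j\<^sup>2) * (q ^ i\<^sup>2 * burge_prod q L i (d * j) (b * j)))"
      by (simp add: sum_distrib_left mult_ac)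
  qed
  also have "\<dots> = (\<Sum>j\<le>L. unit_alpha q j * q ^ (e * j\<^sup>2) *
       (\<Sum>i\<le>L. q ^ i\<^sup>2 * burge_prod q L i (d * j) (b * j)))"
    by (subst sum.swap) (simp add: sum_distrib_left)
  also have "\<dots> = (\<Sum>j\<le>L. qpoch q q (2 * L) * (unit_alpha q j * q ^ (fib (t + 2) * fib (t + 3) * j\<^sup>2) *
        bailey_ker q L (fib (t + 3) * j)))"
  proof (intro sum.cong refl)
    fix j
    have e: "fib (t + 2) * fib (t + 3) * j\<^sup>2 = e * j\<^sup>2 + (b * j)\<^sup>2"
      by (simp add: e_def b_def power2_eq_square algebra_simps numeral_3_eq_3)
    have "2 * (b * j) - d * j = fib (t + 3) * j"
      using b(3) by (simp add: diff_mult_distrib [symmetric] mult.assoc [symmetric])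
    moreover have "d * j \<le> b * j" using b by simp
    ultimately show "unit_alpha q j * q ^ (e * j\<^sup>2) *
       (\<Sum>i\<le>L. q ^ i\<^sup>2 * burge_prod q L i (d * j) (b * j))
      = qpoch q q (2 * L) * (unit_alpha q j * q ^ (fib (t + 2) * fib (t + 3) * j\<^sup>2) *
        bailey_ker q L (fib (t + 3) * j))"
      unfolding e by (simp only: burge_transform_limit power_add mult_ac)
  qed
  finally show ?thesis by (simp add: sum_distrib_left)
qed

end

section \<open>Finite fibres of the multisum\<close>

text \<open>The finite part of the fibre m_1 + m_2 = n that carries the sum, by
  \<open>summand_nonzero_imp_box\<close>. Bounding all entries by the same n makes the later
  coordinates independent, so they can be summed out one by one.\<close>

definition fibre_box :: "nat \<Rightarrow> nat \<Rightarrow> (nat \<Rightarrow> nat) set" where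
  "fibre_box e n = {m. (\<forall>i. i \<notin> {1..e} \<longrightarrow> m i = 0) \<and> (\<forall>i. m i \<le> n) \<and> m 1 + m 2 = n}"

text \<open>\<open>summand\<close> cut down to e variables, with its last factor replaced by a
  function \<open>\<phi>\<close> that absorbs the variables already summed.\<close>

definition chain :: "complex \<Rightarrow> nat \<Rightarrow> (nat \<Rightarrow> nat \<Rightarrow> complex) \<Rightarrow> (nat \<Rightarrow> nat) \<Rightarrow> complex" where
  "chain q e \<phi> m =
     q ^ ((m 1 + m 2)^2 + (\<Sum>i=2..e. (m i)^2)) / (qpoch q q (m 1) * qpoch q q (2 * m 2))
     * (\<Prod>j=3..e-1. qbinom q (int (m (j-1)) + int (m j) - int (m (j+1))) (2 * int (m j)))
     * \<phi> (m (e - 1)) (m e)"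

text \<open>For e >= 2 the new coordinate takes no part in m_1 + m_2 and ranges freely up to
  n.\<close>

lemma sum_fibre_box_Suc:
  assumes "e \<ge> 2"
  shows "(\<Sum>m\<in>fibre_box (Suc e) n. f m) = (\<Sum>m\<in>fibre_box e n. \<Sum>i\<le>n. f (m(Suc e := i)))"
proof -
  have "(\<Sum>m\<in>fibre_box (Suc e) n. f m) = (\<Sum>(m, i)\<in>fibre_box e n \<times> {..n}. f (m(Suc e := i)))"
    by (rule sum.reindex_bij_witness[where i = "\<lambda>(m, i). m(Suc e := i)" and j = "\<lambda>m. (m(Suc e := 0), m (Suc e))"])
       (use assms in \<open>auto simp: fibre_box_def\<close>)
  then show ?thesis by (simp add: sum.cartesian_product)
qed

lemma sum_fibre_box_2:
  "(\<Sum>m\<in>fibre_box 2 n. f m) = (\<Sum>y\<le>n. f ((\<lambda>_. 0)(1 := n - y, 2 := y)))"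
proof (rule sum.reindex_bij_witness[where i = "\<lambda>y. (\<lambda>_. 0)(1 := n - y, 2 := y)" and j = "\<lambda>m. m 2"])
  fix m assume m: "m \<in> fibre_box 2 n"
  then have m1: "m 1 = n - m 2" by (auto simp: fibre_box_def)
  have "m i = 0" if "i \<noteq> 1" "i \<noteq> 2" for i
  proof -
    have "i \<notin> {1..2}" using that by auto
    then show ?thesis using m by (simp add: fibre_box_def)
  qed
  with m1 show *: "(\<lambda>_. 0)(1 := n - m 2, 2 := m 2) = m"
    by (intro ext) auto
  then show "f ((\<lambda>_. 0)(1 := n - m 2, 2 := m 2)) = f m" by simp
qed (auto simp: fibre_box_def)

lemma finite_fibre_box: "finite (fibre_box e n)"
proof -
  have "finite {m :: nat \<Rightarrow> nat. \<forall>i. (i \<in> {1..e} \<longrightarrow> m i \<in> {..n}) \<and> (i \<notin> {1..e} \<longrightarrow> m i = 0)}"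
    by (rule finite_set_of_finite_funs) auto
  then show ?thesis
    by (rule rev_finite_subset) (auto simp: fibre_box_def)
qed

lemma sum_power_squares_le:
  fixes r :: real
  assumes "0 \<le> r" "r < 1"
  shows "(\<Sum>i\<le>n. r ^ i\<^sup>2) \<le> 1 / (1 - r)"
proof -
  have "(\<Sum>i\<le>n. r ^ i\<^sup>2) \<le> (\<Sum>i\<le>n. r ^ i)"
    using assms by (intro sum_mono power_decreasing) (auto simp: power2_eq_square)
  also have "\<dots> \<le> (\<Sum>i. r ^ i)"
    using assms by (intro sum_le_suminf summable_geometric) auto
  also have "\<dots> = 1 / (1 - r)"
    using assms by (intro suminf_geometric) auto
  finally show ?thesis .
qed

text \<open>The bound is uniform in n, so that q^(n^2) alone provides the convergence of the sum
  over n. Each of the e - 1 free entries contributes a geometric series.\<close>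

lemma sum_fibre_box_power_le:
  fixes r :: real
  assumes r: "0 \<le> r" "r < 1" and "e \<ge> 2"
  shows "(\<Sum>m\<in>fibre_box e n. r ^ (\<Sum>i=2..e. (m i)\<^sup>2)) \<le> (1 / (1 - r)) ^ (e - 1)"
  using \<open>e \<ge> 2\<close>
proof (induction e rule: dec_induct)
  case base
  show ?case using sum_power_squares_le[OF r] by (simp add: sum_fibre_box_2)
next
  case (step e)
  have "(\<Sum>m\<in>fibre_box (Suc e) n. r ^ (\<Sum>i=2..Suc e. (m i)\<^sup>2))
      = (\<Sum>m\<in>fibre_box e n. \<Sum>i\<le>n. r ^ (\<Sum>i=2..e. (m i)\<^sup>2) * r ^ i\<^sup>2)"
    using step.hyps by (subst sum_fibre_box_Suc) (auto intro!: sum.cong simp: power_add)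
  also have "\<dots> = (\<Sum>m\<in>fibre_box e n. r ^ (\<Sum>i=2..e. (m i)\<^sup>2)) * (\<Sum>i\<le>n. r ^ i\<^sup>2)"
    by (simp add: sum_product)
  also have "\<dots> \<le> (1 / (1 - r)) ^ (e - 1) * (1 / (1 - r))"
    using step.IH sum_power_squares_le[OF r] r by (intro mult_mono sum_nonneg) auto
  also have "\<dots> = (1 / (1 - r)) ^ (Suc e - 1)"
    using step.hyps by (cases e) auto
  finally show ?case .
qed

lemma qbinom_eq_0: "n < m \<Longrightarrow> qbinom q n m = 0"
  by (simp add: qbinom_def)

text \<open>The value of the sum over the fibre m_1 + m_2 = n, see
  \<open>sum_fibre_box_summand\<close>; the outer q^(n^2) is the term (m_1 + m_2)^2 of the
  exponent.\<close>

definition bailey_sum :: "complex \<Rightarrow> nat \<Rightarrow> nat \<Rightarrow> nat \<Rightarrow> complex" where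
  "bailey_sum q e b n =
     q ^ n\<^sup>2 * (\<Sum>j\<le>n. unit_alpha q j * q ^ (e * j\<^sup>2) * bailey_ker q n (b * j))"

section \<open>Summing out the variables at fixed m_1 + m_2\<close>

context
  fixes q :: complex
  assumes q: "norm q < 1"
begin

lemma summand_eq_chain: "summand q k m = chain q (k - 2) (burge_iter q 0) m"
  by (simp add: summand_def chain_def qbinom_eq_gauss[OF q] numeral_3_eq_3)

text \<open>The last variable i enters only through q^(i^2), the factor j = e of the product and
  \<open>burge_iter q t (m e) i\<close>; together these form one recursion step of
  \<open>burge_iter\<close>.\<close>

lemma sum_chain_Suc:
  assumes e: "e \<ge> 3" and m: "m \<in> fibre_box e n"
  shows "(\<Sum>i\<le>n. chain q (Suc e) (burge_iter q t) (m(Suc e := i))) = chain q e (burge_iter q (Suc t)) m"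
proof -
  obtain c where c: "e = Suc c" "c \<ge> 2" using e by (cases e) auto
  define S where "S = (\<Sum>i=2..e. (m i)^2)"
  define P where "P = (\<Prod>j=3..e-1. qbinom q (int (m (j-1)) + int (m j) - int (m (j+1))) (2 * int (m j)))"
  define A where "A = q ^ ((m 1 + m 2)^2 + S) / (qpoch q q (m 1) * qpoch q q (2 * m 2)) * P"
  define h where "h i = q ^ i\<^sup>2 * qbinom q (int (m (e - 1)) + int (m e) - int i) (2 * int (m e)) * burge_iter q t (m e) i" for i
  have me: "m e \<le> n" using m by (simp add: fibre_box_def)
  have "chain q (Suc e) (burge_iter q t) (m(Suc e := i)) = A * h i" for i
  proof -
    define m' where "m' = m(Suc e := i)"
    have m': "m' j = m j" if "j \<le> e" for j using that by (simp add: m'_def)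
    have m'_Suc: "m' (Suc e) = i" by (simp add: m'_def)
    have "(\<Sum>i=2..Suc e. (m' i)^2) = S + i\<^sup>2"
      using e by (simp add: S_def m' m'_Suc)
    moreover have "(\<Prod>j=3..Suc e-1. qbinom q (int (m' (j-1)) + int (m' j) - int (m' (j+1))) (2 * int (m' j)))
       = P * qbinom q (int (m (e - 1)) + int (m e) - int i) (2 * int (m e))"
    proof -
      have "{3..Suc e - 1} = insert e {3..e - 1}" using e by auto
      moreover have "(\<Prod>j=3..e-1. qbinom q (int (m' (j-1)) + int (m' j) - int (m' (j+1))) (2 * int (m' j))) = P"
        unfolding P_def
      proof (intro prod.cong refl)
        fix j assume "j \<in> {3..e - 1}"
        then have "j - 1 \<le> e" "j \<le> e" "j + 1 \<le> e" by auto
        then show "qbinom q (int (m' (j-1)) + int (m' j) - int (m' (j+1))) (2 * int (m' j))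
          = qbinom q (int (m (j-1)) + int (m j) - int (m (j+1))) (2 * int (m j))"
          by (simp only: m')
      qed
      ultimately show ?thesis using e by (simp add: m' m'_Suc mult.commute)
    qed
    moreover have "m' 1 = m 1" "m' 2 = m 2" "m' (Suc e - 1) = m e" using e by (simp_all add: m')
    ultimately show ?thesis
      unfolding m'_def [symmetric] chain_def m'_Suc
      by (simp only: A_def h_def power_add) (simp add: mult_ac)
  qed
  then have "(\<Sum>i\<le>n. chain q (Suc e) (burge_iter q t) (m(Suc e := i))) = A * (\<Sum>i\<le>n. h i)"
    by (simp add: sum_distrib_left)
  \<comment> \<open>The box allows i up to n, the recursion only up to \<open>m e\<close>; the extra
    terms vanish.\<close>
  also have "(\<Sum>i\<le>n. h i) = (\<Sum>i\<le>m e. h i)"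
    using me by (intro sum.mono_neutral_right) (auto simp: h_def burge_iter_eq_0)
  also have "\<dots> = burge_iter q (Suc t) (m (e - 1)) (m e)"
    unfolding burge_iter.simps h_def
  proof (intro sum.cong refl)
    \<comment> \<open>For i <= \<open>m e\<close> the integer upper entry is nonnegative, so
      \<open>qbinom\<close> can be read as \<open>gauss\<close>.\<close>
    fix i assume "i \<in> {..m e}"
    then have "int (m (e - 1)) + int (m e) - int i = int (m (e - 1) + m e - i)"
      "2 * int (m e) = int (2 * m e)" by auto
    then show "q ^ i\<^sup>2 * qbinom q (int (m (e - 1)) + int (m e) - int i) (2 * int (m e)) * burge_iter q t (m e) i
      = q ^ i\<^sup>2 * gauss q (m (e - 1) + m e - i) (2 * m e) * burge_iter q t (m e) i"
      by (simp only: qbinom_eq_gauss[OF q])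
  qed
  finally show ?thesis unfolding A_def P_def S_def chain_def .
qed

text \<open>The descent stops at three variables, where the product of binomial coefficients in
  \<open>chain\<close> is empty.\<close>

lemma sum_fibre_box_chain:
  "(\<Sum>m\<in>fibre_box (3 + s) n. chain q (3 + s) (burge_iter q t) m)
     = (\<Sum>m\<in>fibre_box 3 n. chain q 3 (burge_iter q (t + s)) m)"
proof (induction s arbitrary: t)
  case (Suc s)
  have "(\<Sum>m\<in>fibre_box (3 + Suc s) n. chain q (3 + Suc s) (burge_iter q t) m)
     = (\<Sum>m\<in>fibre_box (3 + s) n. chain q (3 + s) (burge_iter q (Suc t)) m)"
    unfolding add_Suc_right
    by (subst sum_fibre_box_Suc, simp, rule sum.cong[OF refl], rule sum_chain_Suc) simp_all
  then show ?case using Suc by simp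
qed simp

text \<open>The limit Q -> infinity of \<open>q_vandermonde\<close>, obtained by repeating its
  induction on P rather than by passing to a limit.\<close>

lemma q_vandermonde_limit:
  "(\<Sum>k\<le>P. q ^ (k * (k + d)) * gauss q P k / qpoch q q (k + d)) = 1 / qpoch q q (P + d)"
proof (induction P arbitrary: d)
  case (Suc P)
  have split: "gauss q (Suc P) k = gauss q P k + (if k = 0 then 0 else q ^ (Suc P - k) * gauss q P (k - 1))"
    if "k \<le> Suc P" for k
    using that gauss_Suc_Suc'[of "k - 1" P q] by (cases k) auto
  have "(\<Sum>k\<le>Suc P. q ^ (k * (k + d)) * gauss q (Suc P) k / qpoch q q (k + d))
      = (\<Sum>k\<le>Suc P. q ^ (k * (k + d)) * gauss q P k / qpoch q q (k + d)
         + (if k = 0 then 0 else q ^ (k * (k + d)) * q ^ (Suc P - k) * gauss q P (k - 1) / qpoch q q (k + d)))"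
    by (intro sum.cong refl) (auto simp: split algebra_simps add_divide_distrib)
  also have "\<dots> = (\<Sum>k\<le>Suc P. q ^ (k * (k + d)) * gauss q P k / qpoch q q (k + d))
       + (\<Sum>k\<le>Suc P. if k = 0 then 0 else q ^ (k * (k + d)) * q ^ (Suc P - k) * gauss q P (k - 1) / qpoch q q (k + d))"
    by (rule sum.distrib)
  also have "(\<Sum>k\<le>Suc P. q ^ (k * (k + d)) * gauss q P k / qpoch q q (k + d)) = 1 / qpoch q q (P + d)"
    by (simp add: gauss_eq_0 Suc.IH)
  also have "(\<Sum>k\<le>Suc P. if k = 0 then 0 else q ^ (k * (k + d)) * q ^ (Suc P - k) * gauss q P (k - 1) / qpoch q q (k + d))
     = (\<Sum>k\<le>P. q ^ (Suc k * (Suc k + d)) * q ^ (P - k) * gauss q P k / qpoch q q (Suc k + d))"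
    unfolding sum.atMost_Suc_shift by simp
  also have "\<dots> = (\<Sum>k\<le>P. q ^ Suc (P + d) * (q ^ (k * (k + Suc d)) * gauss q P k / qpoch q q (k + Suc d)))"
  proof (intro sum.cong refl)
    fix k assume "k \<in> {..P}"
    then have "Suc k * (Suc k + d) + (P - k) = Suc (P + d) + k * (k + Suc d)"
      by (simp add: algebra_simps)
    then have e: "q ^ (Suc k * (Suc k + d)) * q ^ (P - k) = q ^ Suc (P + d) * q ^ (k * (k + Suc d))"
      by (simp only: power_add [symmetric])
    show "q ^ (Suc k * (Suc k + d)) * q ^ (P - k) * gauss q P k / qpoch q q (Suc k + d)
      = q ^ Suc (P + d) * (q ^ (k * (k + Suc d)) * gauss q P k / qpoch q q (k + Suc d))"
      unfolding e by (simp only: mult.assoc times_divide_eq_right add_Suc_shift)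
  qed
  also have "\<dots> = q ^ Suc (P + d) * (1 / qpoch q q (P + Suc d))"
    unfolding sum_distrib_left [symmetric] Suc.IH ..
  also have "1 / qpoch q q (P + d) = (1 - q ^ Suc (P + d)) / qpoch q q (Suc P + d)"
    using one_minus_power_nonzero[OF q, of "Suc (P + d)"] by (simp add: qpoch_Suc)
  finally show ?case by (simp add: diff_divide_distrib)
qed simp

text \<open>Bailey's lemma with both free parameters sent to infinity, tested on a single kernel; it
  performs the sum over y = m_2.\<close>

lemma bailey_lemma:
  "(\<Sum>y\<le>n. q ^ y\<^sup>2 / qpoch q q (n - y) * bailey_ker q y c) = q ^ c\<^sup>2 * bailey_ker q n c"
proof (cases "c \<le> n")
  case True
  have "(\<Sum>y\<le>n. q ^ y\<^sup>2 / qpoch q q (n - y) * bailey_ker q y c)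
    = (\<Sum>k\<le>n - c. q ^ c\<^sup>2 / qpoch q q (n - c) * (q ^ (k * (k + 2 * c)) * gauss q (n - c) k / qpoch q q (k + 2 * c)))"
  proof (rule sum_atMost_shift_neutral[where b = c])
    fix k assume k: "k + c \<le> n"
    have "c\<^sup>2 + k * (k + 2 * c) = (k + c)\<^sup>2" by (simp add: power2_eq_square algebra_simps)
    then have e: "q ^ (k + c)\<^sup>2 = q ^ c\<^sup>2 * q ^ (k * (k + 2 * c))"
      by (metis power_add)
    have f: "n - c - k = n - (k + c)" "k + 2 * c = k + c + c" by auto
    show "q ^ (k + c)\<^sup>2 / qpoch q q (n - (k + c)) * bailey_ker q (k + c) c
      = q ^ c\<^sup>2 / qpoch q q (n - c) * (q ^ (k * (k + 2 * c)) * gauss q (n - c) k / qpoch q q (k + 2 * c))"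
      unfolding e gauss_eq[OF q] bailey_ker_def f using k q by (simp add: field_simps)
  next
    fix k assume "n < k + c"
    then have "n - c < k" using True by simp
    then show "q ^ c\<^sup>2 / qpoch q q (n - c) * (q ^ (k * (k + 2 * c)) * gauss q (n - c) k / qpoch q q (k + 2 * c)) = 0"
      by (simp add: gauss_eq_0)
  qed (auto simp: bailey_ker_def)
  also have "\<dots> = q ^ c\<^sup>2 / qpoch q q (n - c) * (1 / qpoch q q (n - c + 2 * c))"
    unfolding sum_distrib_left [symmetric] q_vandermonde_limit ..
  also have "n - c + 2 * c = n + c" using True by simp
  finally show ?thesis using True by (simp add: bailey_ker_def)
next
  case False
  then show ?thesis by (auto simp: bailey_ker_def intro!: sum.neutral)
qed

lemma sum_fibre_box_summand:
  assumes "k \<ge> 5"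
  shows "(\<Sum>m\<in>fibre_box (k - 2) n. summand q k m)
    = bailey_sum q (fib (k - 2) * (fib (k - 3) + fib (k - 2))) (fib (k - 2)) n"
proof -
  \<comment> \<open>The s sums over m_4, ..., m_{k-2} are Burge steps; m_3 and m_2 remain.\<close>
  obtain s where k: "k = s + 5" using assms by (metis le_Suc_ex add.commute)
  define a where "a j = unit_alpha q j * q ^ (fib (s + 2) * fib (s + 3) * j\<^sup>2)" for j
  define b where "b = fib (s + 3)"
  have b: "b > 0" by (simp add: b_def fib_neq_0_nat)
  have "(\<Sum>m\<in>fibre_box (k - 2) n. summand q k m) = (\<Sum>m\<in>fibre_box 3 n. chain q 3 (burge_iter q s) m)"
    using sum_fibre_box_chain[where s = s and n = n and t = 0] by (simp add: k summand_eq_chain)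
  also have "\<dots> = (\<Sum>y\<le>n. \<Sum>i\<le>n. chain q 3 (burge_iter q s) (((\<lambda>_. 0)(1 := n - y, 2 := y))(3 := i)))"
    using sum_fibre_box_Suc[where e = 2 and n = n and f = "chain q 3 (burge_iter q s)"] by (simp add: sum_fibre_box_2)
  also have "\<dots> = (\<Sum>y\<le>n. \<Sum>j\<le>n. q ^ n\<^sup>2 * a j * (q ^ y\<^sup>2 / qpoch q q (n - y) * bailey_ker q y (b * j)))"
  proof (rule sum.cong[OF refl])
    fix y assume "y \<in> {..n}"
    then have y: "y \<le> n" by simp
    define B where "B = q ^ n\<^sup>2 * q ^ y\<^sup>2 / (qpoch q q (n - y) * qpoch q q (2 * y))"
    have "(\<Sum>i\<le>n. chain q 3 (burge_iter q s) (((\<lambda>_. 0)(1 := n - y, 2 := y))(3 := i)))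
      = (\<Sum>i\<le>n. B * (q ^ i\<^sup>2 * burge_iter q s y i))"
    proof (intro sum.cong refl)
      fix i
      have "{2..3 :: nat} = {2, 3}" by auto
      then show "chain q 3 (burge_iter q s) (((\<lambda>_. 0)(1 := n - y, 2 := y))(3 := i)) = B * (q ^ i\<^sup>2 * burge_iter q s y i)"
        using y by (simp add: chain_def B_def power_add)
    qed
    also have "\<dots> = B * (\<Sum>i\<le>y. q ^ i\<^sup>2 * burge_iter q s y i)"
      unfolding sum_distrib_left [symmetric] using y
      by (intro arg_cong2[where f = "(*)"] refl sum.mono_neutral_right) (auto simp: burge_iter_eq_0)
    also have "\<dots> = q ^ n\<^sup>2 * q ^ y\<^sup>2 / qpoch q q (n - y) * (\<Sum>j\<le>y. a j * bailey_ker q y (b * j))"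
      unfolding sum_burge_iter[OF q] a_def b_def B_def using q by simp
    also have "(\<Sum>j\<le>y. a j * bailey_ker q y (b * j)) = (\<Sum>j\<le>n. a j * bailey_ker q y (b * j))"
    proof (rule sum.mono_neutral_left)
      show "\<forall>j\<in>{..n} - {..y}. a j * bailey_ker q y (b * j) = 0"
      proof
        fix j assume "j \<in> {..n} - {..y}"
        moreover have "j \<le> b * j" using b by simp
        ultimately have "\<not> b * j \<le> y" by (meson DiffD2 atMost_iff le_trans)
        then show "a j * bailey_ker q y (b * j) = 0" by (simp add: bailey_ker_def)
      qed
    qed (use y in auto)
    also have "q ^ n\<^sup>2 * q ^ y\<^sup>2 / qpoch q q (n - y) * (\<Sum>j\<le>n. a j * bailey_ker q y (b * j))
      = (\<Sum>j\<le>n. q ^ n\<^sup>2 * a j * (q ^ y\<^sup>2 / qpoch q q (n - y) * bailey_ker q y (b * j)))"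
      by (simp add: sum_distrib_left sum_divide_distrib mult_ac)
    finally show "(\<Sum>i\<le>n. chain q 3 (burge_iter q s) (((\<lambda>_. 0)(1 := n - y, 2 := y))(3 := i)))
      = (\<Sum>j\<le>n. q ^ n\<^sup>2 * a j * (q ^ y\<^sup>2 / qpoch q q (n - y) * bailey_ker q y (b * j)))" .
  qed
  also have "\<dots> = (\<Sum>j\<le>n. q ^ n\<^sup>2 * a j * (\<Sum>y\<le>n. q ^ y\<^sup>2 / qpoch q q (n - y) * bailey_ker q y (b * j)))"
    by (subst sum.swap) (simp add: sum_distrib_left)
  also have "\<dots> = (\<Sum>j\<le>n. q ^ n\<^sup>2 * (unit_alpha q j *
     q ^ (fib (k - 2) * (fib (k - 3) + fib (k - 2)) * j\<^sup>2) * bailey_ker q n (fib (k - 2) * j)))"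
  proof (intro sum.cong refl)
    fix j
    have kb: "fib (k - 2) = b" "fib (k - 3) = fib (s + 2)" by (simp_all add: k b_def add.commute[of _ s])
    \<comment> \<open>F_{k-3} F_{k-2} comes from the sum over m_3, the square of F_{k-2} from
      \<open>bailey_lemma\<close>.\<close>
    have e: "fib (s + 2) * b * j\<^sup>2 + (b * j)\<^sup>2 = b * (fib (s + 2) + b) * j\<^sup>2"
      by (simp add: power2_eq_square algebra_simps)
    show "q ^ n\<^sup>2 * a j * (\<Sum>y\<le>n. q ^ y\<^sup>2 / qpoch q q (n - y) * bailey_ker q y (b * j))
       = q ^ n\<^sup>2 * (unit_alpha q j *
     q ^ (fib (k - 2) * (fib (k - 3) + fib (k - 2)) * j\<^sup>2) * bailey_ker q n (fib (k - 2) * j))"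
      unfolding bailey_lemma kb a_def b_def [symmetric] e [symmetric]
      by (simp only: power_add mult_ac)
  qed
  finally show ?thesis by (simp add: bailey_sum_def sum_distrib_left)
qed

text \<open>A nonzero [a; b] has b <= a. For the product this reads 2 m_j <= m_{j-1} + m_j -
  m_{j+1}, hence m_j <= m_{j-1}; the last factor gives m_{k-2} <= m_{k-3}.\<close>

lemma summand_nonzero_imp_box:
  assumes k: "k \<ge> 5" and m: "m \<in> idx k" and nz: "summand q k m \<noteq> 0"
  shows "m \<in> fibre_box (k - 2) (m 1 + m 2)"
proof -
  have dec: "m (Suc j) \<le> m j" if j: "2 \<le> j" "j \<le> k - 3" for j
  proof (cases "j = k - 3")
    case True
    have "qbinom q (int (m (k-3))) (int (m (k-2))) \<noteq> 0" using nz by (simp add: summand_def)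
    then have "m (k - 2) \<le> m (k - 3)"
      using qbinom_eq_0[of "int (m (k-3))" "int (m (k-2))" q] by linarith
    moreover have "Suc (k - 3) = k - 2" using k by simp
    ultimately show ?thesis using True by simp
  next
    case False
    then have "Suc j \<in> {3..k - 3}" using j by auto
    moreover define h where "h j = qbinom q (int (m (j-1)) + int (m j) - int (m (j+1))) (2 * int (m j))" for j
    have "prod h {3..k - 3} \<noteq> 0"
      using nz by (simp add: summand_def h_def)
    ultimately have "h (Suc j) \<noteq> 0" by (auto simp: prod_zero_iff)
    then have "qbinom q (int (m (Suc j-1)) + int (m (Suc j)) - int (m (Suc j+1))) (2 * int (m (Suc j))) \<noteq> 0"
      unfolding h_def .
    then have "\<not> int (m (Suc j-1)) + int (m (Suc j)) - int (m (Suc j+1)) < 2 * int (m (Suc j))"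
      by (metis qbinom_eq_0)
    then show ?thesis by simp
  qed
  have le: "m (2 + i) \<le> m 2" if "2 + i \<le> k - 2" for i
    using that
  proof (induction i)
    case (Suc i)
    then have "m (2 + i) \<le> m 2" "m (Suc (2 + i)) \<le> m (2 + i)"
      using k by (auto intro!: dec)
    then show ?case by simp
  qed simp
  have "m i \<le> m 1 + m 2" for i
  proof (cases "i \<in> {1..k - 2}")
    case True
    show ?thesis
    proof (cases "i = 1")
      case False
      then have "2 \<le> i" using True by auto
      then have "2 + (i - 2) = i" by simp
      then show ?thesis using le[of "i - 2"] True by simp
    qed simp
  next
    case False
    then show ?thesis using m by (simp add: idx_def)
  qed
  then show ?thesis using m by (simp add: fibre_box_def idx_def)
qed

end

section \<open>Infinite sums and the Jacobi triple product\<close>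

lemma convergent_prod_qpoch:
  assumes "norm q < 1"
  shows "convergent_prod (\<lambda>i. 1 - x * q ^ i :: complex)"
proof (rule abs_convergent_prod_imp_convergent_prod, rule summable_imp_abs_convergent_prod)
  have "summable (\<lambda>i. norm x * norm q ^ i)"
    using assms by (intro summable_mult summable_geometric) simp
  then show "summable (\<lambda>i. norm (1 - x * q ^ i - 1))"
    by (simp add: norm_mult norm_power)
qed

lemma qpoch_tendsto:
  assumes "norm q < 1"
  shows "(\<lambda>n. qpoch x q n) \<longlonglongrightarrow> qpoch_inf x q"
  unfolding qpoch_def qpoch_inf_def
  by (intro has_prod_imp_tendsto' convergent_prod_has_prod convergent_prod_qpoch assms)

definition jacobi_term :: "complex \<Rightarrow> complex \<Rightarrow> complex \<Rightarrow> nat \<Rightarrow> complex" where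
  "jacobi_term q z w j = (if j = 0 then 1 else (-1) ^ j * q ^ (j * (j - 1) div 2) * (z ^ j + w ^ j))"

context
  fixes q :: complex
  assumes q: "norm q < 1"
begin

lemma qpoch_inf_nonzero: "qpoch_inf q q \<noteq> 0"
  unfolding qpoch_inf_def
proof (rule prodinf_nonzero[OF convergent_prod_qpoch[OF q]])
  show "1 - q * q ^ i \<noteq> 0" for i
    using one_minus_power_nonzero[OF q, of "Suc i"] by simp
qed

text \<open>Convergent sequences are bounded, and the reciprocals converge because (q)_infinity is
  nonzero. These uniform bounds feed the dominating series below.\<close>

lemma qpoch_bounds:
  obtains K where "K \<ge> 1" "\<And>n. norm (qpoch q q n) \<le> K" "\<And>n. norm (1 / qpoch q q n) \<le> K"
proof -
  have "Bseq (\<lambda>n. qpoch q q n)"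
    using qpoch_tendsto[OF q] by (intro convergent_imp_Bseq convergentI)
  moreover have "Bseq (\<lambda>n. 1 / qpoch q q n)"
    using tendsto_divide[OF tendsto_const qpoch_tendsto[OF q] qpoch_inf_nonzero]
    by (intro convergent_imp_Bseq convergentI)
  ultimately obtain K1 K2 where "\<And>n. norm (qpoch q q n) \<le> K1" "\<And>n. norm (1 / qpoch q q n) \<le> K2"
    unfolding Bseq_def by blast
  then show ?thesis
    by (intro that[of "max 1 (max K1 K2)"]) (auto simp: le_max_iff_disj)
qed

lemma gauss_bound:
  obtains G where "G \<ge> 1" "\<And>n k. norm (gauss q n k) \<le> G"
proof -
  obtain K where K: "K \<ge> 1" "\<And>n. norm (qpoch q q n) \<le> K" "\<And>n. norm (1 / qpoch q q n) \<le> K"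
    using qpoch_bounds by blast
  have "norm (gauss q n k) \<le> K * (K * K)" for n k
  proof (cases "k \<le> n")
    case True
    have "gauss q n k = qpoch q q n * (1 / qpoch q q k * (1 / qpoch q q (n - k)))"
      using True by (simp add: gauss_eq[OF q])
    also have "norm \<dots> \<le> K * (K * K)"
      unfolding norm_mult using K by (intro mult_mono) auto
    finally show ?thesis .
  qed (use K(1) in \<open>simp add: gauss_eq_0\<close>)
  moreover have "1 * (1 * 1) \<le> K * (K * K)"
    using K(1) by (intro mult_mono) auto
  ultimately show ?thesis using that[of "K * (K * K)"] by simp
qed

lemma gauss_tendsto: "(\<lambda>n. gauss q n k) \<longlonglongrightarrow> 1 / qpoch q q k"
proof -
  have "(\<lambda>n. qpoch q q (n + k) / (qpoch q q k * qpoch q q n)) \<longlonglongrightarrow>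
     qpoch_inf q q / (qpoch q q k * qpoch_inf q q)"
    using qpoch_inf_nonzero q
    by (intro tendsto_intros qpoch_tendsto LIMSEQ_ignore_initial_segment[of _ _ k]) auto
  also have "(\<lambda>n. qpoch q q (n + k) / (qpoch q q k * qpoch q q n)) = (\<lambda>n. gauss q (n + k) k)"
    by (simp add: gauss_eq[OF q])
  finally show ?thesis
    using qpoch_inf_nonzero by (auto intro: LIMSEQ_offset)
qed

text \<open>The limit P -> infinity in \<open>q_vandermonde_limit\<close>; Tannery's theorem applies
  since q^(k(k+d)) is at most \<open>norm q ^ k\<close> in size.\<close>

lemma sums_durfee_rectangle:
  "(\<lambda>l. q ^ (l * (l + d)) / (qpoch q q l * qpoch q q (l + d))) sums (1 / qpoch_inf q q)"
  and summable_norm_durfee_rectangle: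
  "summable (\<lambda>l. norm (q ^ (l * (l + d)) / (qpoch q q l * qpoch q q (l + d))))"
proof -
  obtain K where K: "K \<ge> 1" "\<And>n. norm (qpoch q q n) \<le> K" "\<And>n. norm (1 / qpoch q q n) \<le> K"
    using qpoch_bounds by blast
  obtain G where G: "G \<ge> 1" "\<And>n k. norm (gauss q n k) \<le> G"
    using gauss_bound by blast
  define f where "f k n = q ^ (k * (k + d)) * gauss q n k / qpoch q q (k + d)" for k n
  define g where "g l = q ^ (l * (l + d)) / (qpoch q q l * qpoch q q (l + d))" for l
  have "(f k \<longlongrightarrow> g k) at_top" for k
  proof -
    have "(f k \<longlongrightarrow> q ^ (k * (k + d)) * (1 / qpoch q q k) / qpoch q q (k + d)) at_top"
      unfolding f_def using q by (intro tendsto_intros gauss_tendsto) auto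
    then show ?thesis by (simp add: g_def)
  qed
  moreover have "norm (f k n) \<le> norm q ^ k * G * K" for k n
  proof -
    have "f k n = q ^ (k * (k + d)) * gauss q n k * (1 / qpoch q q (k + d))"
      by (simp add: f_def)
    also have "norm \<dots> \<le> norm q ^ k * G * K"
      unfolding norm_mult norm_power using q K G
      by (intro mult_mono power_decreasing) auto
    finally show ?thesis .
  qed
  moreover have "summable (\<lambda>k. norm q ^ k * G * K)"
    using q by (intro summable_mult2 summable_geometric) simp
  ultimately have *: "summable (\<lambda>n. norm (g n)) \<and> (\<lambda>n. suminf (\<lambda>k. f k n)) \<longlonglongrightarrow> suminf g"
    using tannerys_theorem[where a = f and b = g and F = at_top and M = "\<lambda>k. norm q ^ k * G * K"]
    by (auto intro: always_eventually)
  have "suminf (\<lambda>k. f k n) = 1 / qpoch q q (n + d)" for n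
    using q_vandermonde_limit[OF q, where P = n and d = d]
    by (subst suminf_finite[of "{..n}"]) (auto simp: f_def gauss_eq_0)
  moreover have "(\<lambda>n. 1 / qpoch q q (n + d)) \<longlonglongrightarrow> 1 / qpoch_inf q q"
    using qpoch_inf_nonzero
    by (intro tendsto_intros LIMSEQ_ignore_initial_segment qpoch_tendsto q) auto
  ultimately have "suminf g = 1 / qpoch_inf q q"
    using * LIMSEQ_unique by auto
  then show "g sums (1 / qpoch_inf q q)"
    using * by (metis summable_norm_cancel summable_sums)
  show "summable (\<lambda>l. norm (g l))" using * by simp
qed

text \<open>The limit n -> infinity of Bailey's lemma, for the sum over n = m_1 + m_2. Shifting n by
  c gives the Durfee rectangle series.\<close>

lemma has_sum_bailey_ker:
  "((\<lambda>n. q ^ n\<^sup>2 * bailey_ker q n c) has_sum (q ^ c\<^sup>2 / qpoch_inf q q)) UNIV"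
proof -
  define h where "h l = q ^ (l * (l + 2 * c)) / (qpoch q q l * qpoch q q (l + 2 * c))" for l
  have "(h has_sum (1 / qpoch_inf q q)) UNIV"
    unfolding h_def by (intro norm_summable_imp_has_sum sums_durfee_rectangle summable_norm_durfee_rectangle)
  then have "((\<lambda>l. q ^ c\<^sup>2 * h l) has_sum (q ^ c\<^sup>2 * (1 / qpoch_inf q q))) UNIV"
    by (rule has_sum_cmult_right)
  moreover have "q ^ c\<^sup>2 * h l = q ^ (l + c)\<^sup>2 * bailey_ker q (l + c) c" for l
  proof -
    have "c\<^sup>2 + l * (l + 2 * c) = (l + c)\<^sup>2" by (simp add: power2_eq_square algebra_simps)
    then have e: "q ^ (l + c)\<^sup>2 = q ^ c\<^sup>2 * q ^ (l * (l + 2 * c))"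
      by (metis power_add)
    show ?thesis unfolding e by (simp add: h_def bailey_ker_def mult_2 add.assoc)
  qed
  ultimately have "((\<lambda>l. q ^ (l + c)\<^sup>2 * bailey_ker q (l + c) c) has_sum (q ^ c\<^sup>2 / qpoch_inf q q)) UNIV"
    by simp
  moreover have "bij_betw (\<lambda>l. l + c) UNIV {c..}"
    by (rule bij_betwI[where g = "\<lambda>n. n - c"]) auto
  ultimately have "((\<lambda>n. q ^ n\<^sup>2 * bailey_ker q n c) has_sum (q ^ c\<^sup>2 / qpoch_inf q q)) {c..}"
    using has_sum_reindex_bij_betw[of "\<lambda>l. l + c" UNIV "{c..}" "\<lambda>n. q ^ n\<^sup>2 * bailey_ker q n c"]
    by simp
  also have "?this \<longleftrightarrow> ?thesis"
    by (rule has_sum_cong_neutral) (auto simp: bailey_ker_def)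
  finally show ?thesis .
qed

text \<open>Exchanges the sums over n and j. Only the existence of S is claimed; its value follows
  later by comparing the theta series with the triple product.\<close>

lemma has_sum_bailey_sum:
  assumes "b > 0" "e > 0"
  obtains S where "(bailey_sum q e b has_sum S) UNIV"
    and "(\<lambda>j. unit_alpha q j * q ^ (e * j\<^sup>2 + (b * j)\<^sup>2)) sums (S * qpoch_inf q q)"
proof -
  obtain K where K: "K \<ge> 1" "\<And>n. norm (qpoch q q n) \<le> K" "\<And>n. norm (1 / qpoch q q n) \<le> K"
    using qpoch_bounds by blast
  define r where "r = norm q"
  have r: "0 \<le> r" "r < 1" using q by (auto simp: r_def)
  define f where "f = (\<lambda>(n, j). unit_alpha q j * q ^ (e * j\<^sup>2) * (q ^ n\<^sup>2 * bailey_ker q n (b * j)))"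
  \<comment> \<open>K * K bounds the kernel and 2 bounds \<open>unit_alpha\<close>; the powers of r
    come from q^(n^2) and q^(e j^2), the latter by e > 0.\<close>
  define M where "M = (\<lambda>(n, j). r ^ n * (r ^ j * (2 * (K * K))))"
  have geo: "((\<lambda>n. r ^ n) has_sum (1 / (1 - r))) UNIV"
    using r by (intro norm_summable_imp_has_sum) (auto intro: geometric_sums simp: summable_geometric)
  have "M summable_on UNIV \<times> UNIV"
  proof (rule summable_on_SigmaI)
    show "((\<lambda>j. M (n, j)) has_sum (r ^ n * (1 / (1 - r) * (2 * (K * K))))) UNIV" for n
      unfolding M_def prod.case by (intro has_sum_cmult_right has_sum_cmult_left geo)
    show "(\<lambda>n. r ^ n * (1 / (1 - r) * (2 * (K * K)))) summable_on UNIV"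
      by (rule has_sum_imp_summable[OF has_sum_cmult_left[OF geo]])
  qed (use r K in \<open>auto simp: M_def\<close>)
  moreover have "norm (f x) \<le> M x" for x
  proof -
    obtain n j where x: "x = (n, j)" by (cases x)
    have ker: "norm (bailey_ker q n (b * j)) \<le> K * K"
    proof (cases "b * j \<le> n")
      case True
      have "bailey_ker q n (b * j) = 1 / qpoch q q (n - b * j) * (1 / qpoch q q (n + b * j))"
        using True by (simp add: bailey_ker_def)
      also have "norm \<dots> \<le> K * K"
        unfolding norm_mult using K by (intro mult_mono) auto
      finally show ?thesis .
    next
      case False
      then show ?thesis using K(1) by (simp add: bailey_ker_def)
    qed
    have al: "norm (unit_alpha q j) \<le> 2"
    proof (cases "j = 0")
      case False
      have "norm (1 + q ^ j) \<le> 1 + r ^ j"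
        using norm_triangle_ineq[of 1 "q ^ j"] by (simp add: norm_power r_def)
      also have "\<dots> \<le> 2" using r by (simp add: power_le_one)
      finally have "norm (1 + q ^ j) \<le> 2" .
      moreover have "r ^ (j * (j - 1) div 2) \<le> 1" using r by (simp add: power_le_one)
      ultimately have "r ^ (j * (j - 1) div 2) * norm (1 + q ^ j) \<le> 1 * 2"
        by (intro mult_mono) auto
      then show ?thesis using False by (simp add: unit_alpha_def norm_mult norm_power r_def)
    qed (simp add: unit_alpha_def)
    have "j \<le> 1 * j\<^sup>2" by (simp add: power2_eq_square)
    also have "\<dots> \<le> e * j\<^sup>2" using assms by (intro mult_right_mono) auto
    finally have "j \<le> e * j\<^sup>2" .
    then have "r ^ (e * j\<^sup>2) \<le> r ^ j" using r by (intro power_decreasing) auto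
    moreover have "r ^ n\<^sup>2 \<le> r ^ n" using r by (intro power_decreasing) (auto simp: power2_eq_square)
    ultimately have "norm (f x) \<le> 2 * r ^ j * (r ^ n * (K * K))"
      unfolding x f_def prod.case norm_mult norm_power r_def [symmetric]
      using al ker r by (intro mult_mono) auto
    then show ?thesis by (simp add: x M_def mult_ac)
  qed
  ultimately have "(\<lambda>x. norm (f x)) summable_on UNIV \<times> UNIV"
    by (rule summable_on_comparison_test) auto
  then have "f summable_on UNIV \<times> UNIV" by (rule Infinite_Sum.abs_summable_summable)
  then obtain S where S: "(f has_sum S) (UNIV \<times> UNIV)" by (auto simp: summable_on_def)
  have "(bailey_sum q e b has_sum S) UNIV"
  proof (rule has_sum_SigmaD[OF S])
    fix n
    show "((\<lambda>j. f (n, j)) has_sum bailey_sum q e b n) UNIV"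
    proof (rule has_sum_finite_neutralI[of "{..n}"])
      fix j assume "j \<in> UNIV - {..n}"
      moreover have "j \<le> b * j" using assms by simp
      ultimately have "\<not> b * j \<le> n" by (meson DiffD2 atMost_iff le_trans)
      then show "f (n, j) = 0" by (simp add: f_def bailey_ker_def)
    qed (auto simp: f_def bailey_sum_def sum_distrib_left mult_ac)
  qed
  moreover have "((\<lambda>j. unit_alpha q j * q ^ (e * j\<^sup>2) * (q ^ (b * j)\<^sup>2 / qpoch_inf q q)) has_sum S) UNIV"
  proof (rule has_sum_SigmaD)
    show "((\<lambda>(j, n). f (n, j)) has_sum S) (UNIV \<times> UNIV)"
      using S has_sum_swap by blast
    show "((\<lambda>n. case (j, n) of (j, n) \<Rightarrow> f (n, j)) has_sum
       unit_alpha q j * q ^ (e * j\<^sup>2) * (q ^ (b * j)\<^sup>2 / qpoch_inf q q)) UNIV" for j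
      unfolding f_def prod.case by (intro has_sum_cmult_right has_sum_bailey_ker)
  qed
  then have "(\<lambda>j. unit_alpha q j * q ^ (e * j\<^sup>2) * (q ^ (b * j)\<^sup>2 / qpoch_inf q q) * qpoch_inf q q) sums (S * qpoch_inf q q)"
    by (intro has_sum_imp_sums has_sum_cmult_left)
  then have "(\<lambda>j. unit_alpha q j * q ^ (e * j\<^sup>2 + (b * j)\<^sup>2)) sums (S * qpoch_inf q q)"
    using qpoch_inf_nonzero by (simp add: power_add mult.assoc)
  ultimately show ?thesis by (rule that)
qed

text \<open>Here w stands for q / z, without a division, so that z = 0 is included. When both
  products are expanded, the terms with fixed difference of the two indices form a q-Vandermonde
  sum.\<close>

lemma finite_jacobi_triple_product:
  assumes zw: "z * w = q"
  shows "qpoch z q n * qpoch w q n = (\<Sum>j\<le>n. jacobi_term q z w j * gauss q (2 * n) (n + j))"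
proof -
  define T where "T k = k * (k - 1) div 2" for k :: nat
  have T_add: "T (l + j) + T l + l = T j + l * (l + j)" for l j
  proof (induction l)
    case (Suc l)
    have "T (Suc l) = T l + l" "T (Suc (l + j)) = T (l + j) + (l + j)"
      unfolding T_def by (rule triangle_Suc)+
    then show ?case using Suc by (simp add: algebra_simps)
  qed (simp add: T_def)
  define u where "u x k = (-1) ^ k * q ^ T k * gauss q n k * x ^ k" for x k
  have u_nz: "k \<le> n" if "u x k \<noteq> 0" for x k
    using that by (cases "k \<le> n") (auto simp: u_def gauss_eq_0)
  have diag: "(\<Sum>l\<le>n. u x (l + j) * u y l) = (-1) ^ j * q ^ T j * x ^ j * gauss q (2 * n) (n + j)"
    if xy: "x * y = q" for x y j
  proof -
    have "u x (l + j) * u y l = ((-1) ^ j * q ^ T j * x ^ j) * (q ^ (l * (l + j)) * gauss q n l * gauss q n (l + j))" for l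
    proof -
      have "u x (l + j) * u y l = ((-1) ^ (l + j) * (-1) ^ l) * (q ^ T (l + j) * q ^ T l) * (x ^ (l + j) * y ^ l)
          * (gauss q n l * gauss q n (l + j))"
        by (simp add: u_def mult_ac)
      also have "(-1) ^ (l + j) * (-1) ^ l = ((-1) ^ j :: complex)"
        by (auto simp: uminus_power_if)
      also have "x ^ (l + j) * y ^ l = x ^ j * q ^ l"
        unfolding xy [symmetric] by (simp add: power_add power_mult_distrib mult_ac)
      also have "(-1) ^ j * (q ^ T (l + j) * q ^ T l) * (x ^ j * q ^ l)
        = (-1) ^ j * x ^ j * q ^ (T (l + j) + T l + l)"
        by (simp add: power_add mult_ac)
      finally show ?thesis unfolding T_add by (simp add: power_add mult_ac)
    qed
    then have "(\<Sum>l\<le>n. u x (l + j) * u y l)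
      = ((-1) ^ j * q ^ T j * x ^ j) * (\<Sum>l\<le>n. q ^ (l * (l + j)) * gauss q n l * gauss q n (l + j))"
      by (simp only: sum_distrib_left)
    then show ?thesis unfolding q_vandermonde by (simp add: mult_2)
  qed
  have "qpoch z q n * qpoch w q n = (\<Sum>k\<le>n. \<Sum>l\<le>n. u z k * u w l)"
    unfolding q_binomial_theorem u_def T_def by (rule sum_product)
  also have "\<dots> = (\<Sum>(k, l)\<in>{..n} \<times> {..n}. u z k * u w l)"
    by (rule sum.cartesian_product)
  \<comment> \<open>Differences k - l >= 0 yield the powers of z, negative ones those of w. The
    diagonal is counted once, whence the value 1 of \<open>jacobi_term\<close> at j = 0.\<close>
  also have "{..n} \<times> {..n} = {(k, l). l \<le> k \<and> k \<le> n} \<union> {(k, l). k < l \<and> l \<le> n}"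
    by auto
  also have "(\<Sum>(k, l)\<in>\<dots>. u z k * u w l)
     = (\<Sum>(k, l) | l \<le> k \<and> k \<le> n. u z k * u w l) + (\<Sum>(k, l) | k < l \<and> l \<le> n. u z k * u w l)"
  proof (rule sum.union_disjoint)
    show "finite {(k, l). l \<le> k \<and> k \<le> n}"
      by (rule finite_subset[of _ "{..n} \<times> {..n}"]) auto
    show "finite {(k, l). k < l \<and> l \<le> n}"
      by (rule finite_subset[of _ "{..n} \<times> {..n}"]) auto
  qed auto
  also have "(\<Sum>(k, l) | l \<le> k \<and> k \<le> n. u z k * u w l)
     = (\<Sum>(j, l) \<in> {(j, l). j + l \<le> n}. u z (l + j) * u w l)"
    by (rule sum.reindex_bij_witness[where i = "\<lambda>(j, l). (l + j, l)" and j = "\<lambda>(k, l). (k - l, l)"]) auto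
  also have "\<dots> = (\<Sum>(j, l) \<in> {..n} \<times> {..n}. u z (l + j) * u w l)"
    by (rule sum.mono_neutral_left) (auto dest: u_nz simp: add.commute)
  also have "\<dots> = (\<Sum>j\<le>n. (-1) ^ j * q ^ T j * z ^ j * gauss q (2 * n) (n + j))"
    by (simp add: sum.cartesian_product [symmetric] diag[OF zw])
  also have "(\<Sum>(k, l) | k < l \<and> l \<le> n. u z k * u w l)
     = (\<Sum>(j, l) \<in> {(j, l). j + l \<le> n \<and> j > 0}. u w (l + j) * u z l)"
    by (rule sum.reindex_bij_witness[where i = "\<lambda>(j, l). (l, l + j)" and j = "\<lambda>(k, l). (l - k, k)"]) auto
  also have "\<dots> = (\<Sum>(j, l) \<in> {1..n} \<times> {..n}. u w (l + j) * u z l)"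
    by (rule sum.mono_neutral_left) (auto dest: u_nz simp: add.commute)
  also have "\<dots> = (\<Sum>j=1..n. (-1) ^ j * q ^ T j * w ^ j * gauss q (2 * n) (n + j))"
    using zw by (simp add: sum.cartesian_product [symmetric] diag[of w z] mult.commute[of w z])
  also have "\<dots> = (\<Sum>j\<le>n. if j = 0 then 0 else (-1) ^ j * q ^ T j * w ^ j * gauss q (2 * n) (n + j))"
    by (rule sum.mono_neutral_cong_left) auto
  also have "(\<Sum>j\<le>n. (-1) ^ j * q ^ T j * z ^ j * gauss q (2 * n) (n + j)) + \<dots>
     = (\<Sum>j\<le>n. jacobi_term q z w j * gauss q (2 * n) (n + j))"
    unfolding sum.distrib [symmetric]
    by (intro sum.cong refl) (auto simp: jacobi_term_def T_def algebra_simps)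
  finally show ?thesis .
qed

text \<open>Tannery's theorem for the finite version: [2n; n+j] tends to 1/(q)_infinity for each j,
  and the bounds on z and w give a geometric dominating series.\<close>

lemma jacobi_triple_product:
  assumes zw: "z * w = q" and z: "norm z < 1" and w: "norm w < 1"
  shows "jacobi_term q z w sums (qpoch_inf z q * qpoch_inf w q * qpoch_inf q q)"
proof -
  obtain G where G: "G \<ge> 1" "\<And>n k. norm (gauss q n k) \<le> G"
    using gauss_bound by blast
  define f where "f j n = jacobi_term q z w j * gauss q (2 * n) (n + j)" for j n
  define g where "g j = jacobi_term q z w j * (1 / qpoch_inf q q)" for j
  define M where "M j = 2 * (norm z ^ j + norm w ^ j) * G" for j
  have "(f j \<longlongrightarrow> g j) at_top" for j
  proof -
    \<comment> \<open>With n + j in place of n the lower entry n + 2j never exceeds the upper one,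
      so the quotient formula holds for every n.\<close>
    have "(\<lambda>n. qpoch q q (2 * (n + j)) / (qpoch q q (n + (j + j)) * qpoch q q n))
       \<longlonglongrightarrow> qpoch_inf q q / (qpoch_inf q q * qpoch_inf q q)"
    proof (intro tendsto_intros)
      show "(\<lambda>n. qpoch q q (2 * (n + j))) \<longlonglongrightarrow> qpoch_inf q q"
        by (rule filterlim_compose[OF qpoch_tendsto[OF q]])
           (rule filterlim_subseq, auto simp: strict_mono_def)
      show "(\<lambda>n. qpoch q q (n + (j + j))) \<longlonglongrightarrow> qpoch_inf q q"
        by (intro LIMSEQ_ignore_initial_segment qpoch_tendsto q)
    qed (use qpoch_tendsto[OF q, of q] qpoch_inf_nonzero in simp_all)
    moreover have "qpoch q q (2 * (n + j)) / (qpoch q q (n + (j + j)) * qpoch q q n)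
       = gauss q (2 * (n + j)) (n + j + j)" for n
      by (simp add: gauss_eq[OF q] add.assoc)
    ultimately have "(\<lambda>n. gauss q (2 * (n + j)) (n + j + j)) \<longlonglongrightarrow> 1 / qpoch_inf q q"
      using qpoch_inf_nonzero by simp
    then have "(\<lambda>n. gauss q (2 * n) (n + j)) \<longlonglongrightarrow> 1 / qpoch_inf q q"
      by (rule LIMSEQ_offset[where k = j])
    then show ?thesis unfolding f_def g_def by (intro tendsto_intros)
  qed
  moreover have "norm (f j n) \<le> M j" for j n
  proof -
    have "norm (jacobi_term q z w j) \<le> 2 * (norm z ^ j + norm w ^ j)"
    proof (cases "j = 0")
      case False
      have "norm (z ^ j + w ^ j) \<le> norm z ^ j + norm w ^ j"
        using norm_triangle_ineq[of "z ^ j" "w ^ j"] by (simp add: norm_power)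
      moreover have "norm q ^ (j * (j - 1) div 2) \<le> 1" using q by (simp add: power_le_one)
      ultimately have "norm q ^ (j * (j - 1) div 2) * norm (z ^ j + w ^ j) \<le> 2 * (norm z ^ j + norm w ^ j)"
        by (intro mult_mono) auto
      then show ?thesis using False by (simp add: jacobi_term_def norm_mult norm_power)
    qed (simp add: jacobi_term_def)
    then show ?thesis unfolding f_def M_def norm_mult using G by (intro mult_mono) auto
  qed
  moreover have "summable M"
    unfolding M_def using z w by (intro summable_mult summable_mult2 summable_add summable_geometric) auto
  ultimately have *: "summable (\<lambda>n. norm (g n)) \<and> (\<lambda>n. suminf (\<lambda>j. f j n)) \<longlonglongrightarrow> suminf g"
    using tannerys_theorem[where a = f and b = g and F = at_top and M = M]
    by (auto intro: always_eventually)
  have "suminf (\<lambda>j. f j n) = qpoch z q n * qpoch w q n" for n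
    using finite_jacobi_triple_product[OF zw, of n]
    by (subst suminf_finite[of "{..n}"]) (auto simp: f_def gauss_eq_0)
  moreover have "(\<lambda>n. qpoch z q n * qpoch w q n) \<longlonglongrightarrow> qpoch_inf z q * qpoch_inf w q"
    by (intro tendsto_intros qpoch_tendsto q)
  ultimately have "suminf g = qpoch_inf z q * qpoch_inf w q"
    using * LIMSEQ_unique by auto
  then have "g sums (qpoch_inf z q * qpoch_inf w q)"
    using * by (metis summable_norm_cancel summable_sums)
  then have "(\<lambda>j. g j * qpoch_inf q q) sums (qpoch_inf z q * qpoch_inf w q * qpoch_inf q q)"
    by (rule sums_mult2)
  then show ?thesis using qpoch_inf_nonzero by (simp add: g_def)
qed

section \<open>Absolute convergence of the multisum and summation by fibres\<close>

lemma norm_summand_le: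
  obtains C where "C \<ge> 0"
    "\<And>m. norm (summand q k m) \<le> C * norm q ^ (m 1 + m 2)\<^sup>2 * norm q ^ (\<Sum>i=2..k-2. (m i)\<^sup>2)"
proof -
  obtain K where K: "K \<ge> 1" "\<And>n. norm (qpoch q q n) \<le> K" "\<And>n. norm (1 / qpoch q q n) \<le> K"
    using qpoch_bounds by blast
  define B where "B = K * (K * K)"
  have B: "B \<ge> 0" using K(1) by (simp add: B_def)
  have qb: "norm (qbinom q n m) \<le> B" for n m
  proof (cases "0 \<le> m \<and> m \<le> n")
    case True
    have "qbinom q n m = qpoch q q (nat n) * (1 / qpoch q q (nat m) * (1 / qpoch q q (nat (n - m))))"
      using True by (simp add: qbinom_def)
    also have "norm \<dots> \<le> B"
      unfolding norm_mult B_def using K by (intro mult_mono) auto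
    finally show ?thesis .
  next
    case False
    then have "qbinom q n m = 0" unfolding qbinom_def by (rule if_not_P)
    then show ?thesis using B by simp
  qed
  have pr: "norm (\<Prod>j=3..k-3. qbinom q (int (m (j-1)) + int (m j) - int (m (j+1))) (2 * int (m j)))
      \<le> (\<Prod>j=3..k-3. B)" for m
    unfolding prod_norm [symmetric] using qb by (intro prod_mono) auto
  show ?thesis
  proof (rule that[of "K * K * (\<Prod>j=3..k-3. B) * B"])
    show "0 \<le> K * K * (\<Prod>j=3..k-3. B) * B"
      using B K(1) by (intro mult_nonneg_nonneg prod_nonneg) auto
    fix m :: "nat \<Rightarrow> nat"
    define E where "E = (m 1 + m 2)\<^sup>2 + (\<Sum>i=2..k-2. (m i)\<^sup>2)"
    have "summand q k m = q ^ E * (1 / qpoch q q (m 1) * (1 / qpoch q q (2 * m 2)))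
      * (\<Prod>j=3..k-3. qbinom q (int (m (j-1)) + int (m j) - int (m (j+1))) (2 * int (m j)))
      * qbinom q (int (m (k-3))) (int (m (k-2)))"
      by (simp add: summand_def E_def)
    also have "norm \<dots> \<le> norm q ^ E * (K * K) * (\<Prod>j=3..k-3. B) * B"
      unfolding norm_mult[of _ "qbinom q (int (m (k-3))) (int (m (k-2)))"]
        norm_mult[of _ "prod _ _"] norm_mult[of "q ^ E"] norm_mult[of "1 / _"] norm_power
      using K B pr[of m] qb
      by (intro mult_mono mult_nonneg_nonneg prod_nonneg order_refl) auto
    also have "\<dots> = K * K * (\<Prod>j=3..k-3. B) * B * norm q ^ (m 1 + m 2)\<^sup>2 * norm q ^ (\<Sum>i=2..k-2. (m i)\<^sup>2)"
      by (simp only: E_def power_add mult_ac)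
    finally show "norm (summand q k m) \<le> \<dots>" .
  qed
qed

lemma has_sum_summand:
  assumes k: "k \<ge> 5" and S: "(bailey_sum q (fib (k - 2) * (fib (k - 3) + fib (k - 2))) (fib (k - 2)) has_sum S) UNIV"
  shows "(summand q k has_sum S) (idx k)"
proof -
  \<comment> \<open>Unlike the boxes, these fibres partition \<open>idx k\<close>, as the
    rearrangement requires; they are infinite, but the summand vanishes off the box.\<close>
  define fibre where "fibre n = {m \<in> idx k. m 1 + m 2 = n}" for n
  define f where "f = (\<lambda>(n :: nat, m). summand q k m)"
  have sub: "fibre_box (k - 2) n \<subseteq> fibre n" for n
    by (auto simp: fibre_box_def fibre_def idx_def)
  have zero: "summand q k m = 0" if "m \<in> fibre n - fibre_box (k - 2) n" for m n
    using summand_nonzero_imp_box[OF q k, of m] that by (auto simp: fibre_def)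
  obtain C where C: "C \<ge> 0"
    "\<And>m. norm (summand q k m) \<le> C * norm q ^ (m 1 + m 2)\<^sup>2 * norm q ^ (\<Sum>i=2..k-2. (m i)\<^sup>2)"
    using norm_summand_le by blast
  \<comment> \<open>A box with k - 2 variables has (k - 2) - 1 free entries.\<close>
  define D where "D = C * (1 / (1 - norm q)) ^ (k - 3)"
  have D: "D \<ge> 0" using C q by (simp add: D_def)
  have "(\<lambda>x. norm (f x)) summable_on Sigma UNIV fibre"
  proof (rule summable_on_SigmaI)
    show "((\<lambda>m. norm (f (n, m))) has_sum (\<Sum>m\<in>fibre_box (k - 2) n. norm (summand q k m))) (fibre n)" for n
      by (rule has_sum_finite_neutralI[OF finite_fibre_box sub]) (auto simp: f_def zero)
    show "(\<lambda>n. \<Sum>m\<in>fibre_box (k - 2) n. norm (summand q k m)) summable_on UNIV"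
    proof (rule summable_on_comparison_test)
      show "(\<lambda>n. D * norm q ^ n) summable_on UNIV"
        using q D by (subst summable_on_UNIV_nonneg_real_iff) (auto intro!: summable_mult summable_geometric)
      fix n
      have "(\<Sum>m\<in>fibre_box (k - 2) n. norm (summand q k m))
        \<le> (\<Sum>m\<in>fibre_box (k - 2) n. C * norm q ^ n\<^sup>2 * norm q ^ (\<Sum>i=2..k-2. (m i)\<^sup>2))"
        using C(2) by (intro sum_mono) (force simp: fibre_box_def)
      also have "\<dots> = C * norm q ^ n\<^sup>2 * (\<Sum>m\<in>fibre_box (k - 2) n. norm q ^ (\<Sum>i=2..k-2. (m i)\<^sup>2))"
        by (simp add: sum_distrib_left)
      also have "\<dots> \<le> C * norm q ^ n * (1 / (1 - norm q)) ^ (k - 2 - 1)"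
        using C q k
        by (intro mult_mono sum_fibre_box_power_le power_decreasing sum_nonneg) (auto simp: power2_eq_square)
      also have "\<dots> = D * norm q ^ n" using k by (simp add: D_def numeral_3_eq_3)
      finally show "(\<Sum>m\<in>fibre_box (k - 2) n. norm (summand q k m)) \<le> D * norm q ^ n" .
    qed (auto intro: sum_nonneg)
  qed auto
  then have "f summable_on Sigma UNIV fibre"
    by (rule Infinite_Sum.abs_summable_summable)
  moreover have "((\<lambda>m. f (n, m)) has_sum
      bailey_sum q (fib (k - 2) * (fib (k - 3) + fib (k - 2))) (fib (k - 2)) n) (fibre n)" for n
    by (rule has_sum_finite_neutralI[OF finite_fibre_box sub])
       (auto simp: f_def zero sum_fibre_box_summand[OF q k])
  ultimately have "(f has_sum S) (Sigma UNIV fibre)"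
    using S by (intro has_sum_SigmaI) auto
  also have "?this \<longleftrightarrow> ?thesis"
    by (rule has_sum_reindex_bij_witness[where i = "\<lambda>m. (m 1 + m 2, m)" and j = snd])
       (auto simp: fibre_def f_def)
  finally show ?thesis .
qed

end

section \<open>Evaluation of the theta series with N = F_k F_{k-2}\<close>

theorem theorem1p6:
  fixes q :: complex and k :: nat
  assumes "norm q < 1" and "k \<ge> 5"
  shows "(summand q k has_sum
           (let N = fib k * fib (k-2) in
              qpoch_inf (q ^ N) (q ^ (2*N+1)) * qpoch_inf (q ^ (N+1)) (q ^ (2*N+1))
              * qpoch_inf (q ^ (2*N+1)) (q ^ (2*N+1)) / qpoch_inf q q)) (idx k)"
proof -
  note q = assms(1)
  obtain s where k: "k = s + 5" using assms by (metis le_Suc_ex add.commute)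
  define N where "N = fib k * fib (k - 2)"
  define Q where "Q = q ^ (2 * N + 1)"
  define b where "b = fib (k - 2)"
  define e where "e = b * (fib (k - 3) + b)"
  have b: "b > 0" using assms by (simp add: b_def fib_neq_0_nat)
  then have e: "e > 0" by (simp add: e_def)
  have N: "N > 0" using assms by (simp add: N_def fib_neq_0_nat)
  \<comment> \<open>F_k = F_{k-1} + F_{k-2} = F_{k-3} + 2 F_{k-2}, so the collected exponent e + b^2
    is F_{k-2} F_k = N.\<close>
  have "fib k = fib (k - 3) + b + b"
    using fib.simps(3)[of "s + 3"] fib.simps(3)[of "s + 2"]
    by (simp add: k b_def eval_nat_numeral)
  then have Ne: "e * j\<^sup>2 + (b * j)\<^sup>2 = N * j\<^sup>2" for j
    by (simp add: e_def N_def b_def [symmetric] power2_eq_square algebra_simps)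
  have small: "norm (q ^ n) < 1" if "n > 0" for n
    using that q by (simp add: norm_power power_less_one_iff)
  have Q: "norm Q < 1" unfolding Q_def by (rule small) simp
  obtain S where S: "(bailey_sum q e b has_sum S) UNIV"
    "(\<lambda>j. unit_alpha q j * q ^ (e * j\<^sup>2 + (b * j)\<^sup>2)) sums (S * qpoch_inf q q)"
    using has_sum_bailey_sum[OF q b e] .
  \<comment> \<open>The arguments q^N and q^(N+1) multiply to the base, and Q^(j(j-1)/2) (q^N)^j =
    q^(j(j-1)/2 + N j^2) reproduces the theta series.\<close>
  have "jacobi_term Q (q ^ N) (q ^ (N + 1)) sums
     (qpoch_inf (q ^ N) Q * qpoch_inf (q ^ (N + 1)) Q * qpoch_inf Q Q)"
  proof (rule jacobi_triple_product[OF Q])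
    show "q ^ N * q ^ (N + 1) = Q" by (simp only: Q_def mult_2 power_add mult.assoc)
  qed (use N in \<open>auto intro!: small simp del: power_Suc\<close>)
  also have "jacobi_term Q (q ^ N) (q ^ (N + 1)) = (\<lambda>j. unit_alpha q j * q ^ (N * j\<^sup>2))"
  proof
    fix j :: nat
    define T where "T = j * (j - 1) div 2"
    have "even (j * (j - 1))" by (cases j) auto
    then have "2 * T = j * (j - 1)" unfolding T_def by simp
    then have "2 * T + j = j\<^sup>2" by (cases j) (auto simp: power2_eq_square)
    then have "N * j\<^sup>2 = N * (2 * T + j)" by simp
    then have ex: "(2 * N + 1) * T + N * j = T + N * j\<^sup>2"
      by (simp add: algebra_simps)
    have "Q ^ T * ((q ^ N) ^ j + (q ^ (N + 1)) ^ j) = q ^ ((2 * N + 1) * T + N * j) * (1 + q ^ j)"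
    proof -
      have "Q ^ T = q ^ ((2 * N + 1) * T)" "(q ^ N) ^ j = q ^ (N * j)"
        "(q ^ (N + 1)) ^ j = q ^ (N * j) * q ^ j"
        unfolding Q_def power_mult [symmetric] by (simp_all add: power_add)
      then show ?thesis by (simp only: power_add distrib_left mult_1_right mult.assoc)
    qed
    also have "\<dots> = q ^ T * (1 + q ^ j) * q ^ (N * j\<^sup>2)"
      unfolding ex by (simp only: power_add mult_ac)
    finally show "jacobi_term Q (q ^ N) (q ^ (N + 1)) j = unit_alpha q j * q ^ (N * j\<^sup>2)"
      by (simp add: jacobi_term_def unit_alpha_def T_def mult.assoc)
  qed
  finally have "qpoch_inf (q ^ N) Q * qpoch_inf (q ^ (N + 1)) Q * qpoch_inf Q Q = S * qpoch_inf q q"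
    using S(2) unfolding Ne by (rule sums_unique2)
  then have "S = qpoch_inf (q ^ N) Q * qpoch_inf (q ^ (N + 1)) Q * qpoch_inf Q Q / qpoch_inf q q"
    using qpoch_inf_nonzero[OF q] by (simp add: field_simps)
  moreover have "(summand q k has_sum S) (idx k)"
    using S(1) unfolding e_def b_def by (rule has_sum_summand[OF q assms(2)])
  ultimately show ?thesis by (simp add: Let_def N_def [symmetric] Q_def)
qed

end
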